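(* Let $d\ge2$ and suppose that the family $(A_g)_{g\in E}$ satisfies Assumptions 1)–9) listed in the context. Let $e=\frac1{\sqrt d}(1,\dots,1)\in\mathbb{R}^d$, let $a=(a_1,\dots,a_d)\in\mathbb{R}^d$ satisfy $\langle e,a\rangle>0$, put $2r=\langle e,a\rangle$, and let $$T_1=\prod_{i=1}^d(-\infty,0],\qquad T_2=\prod_{i=1}^d[a_i,+\infty).$$ Then $$\beta(T_1,T_2)\le16\sum_{k=1}^\infty k^{d-1}e^{-F(Ck)},$$ where $C=\frac{2R}{dH}$, $R=\frac rH$ and $H=2(A+M)$, with $M$ and $A$ the constants of Assumptions 5) and 8) respectively.
   Context: Notation. $\mathbb{R}^+=[0,\infty)$, $E=\mathbb{R}^d\times\mathbb{R}^+$, $|\cdot|$ and $\langle\cdot,\cdot\rangle$ are the Euclidean norm and inner product, $B(0,r)=\{x\in\mathbb{R}^d: |x|\le r\}$. A germ is a point $g=(x_g,t_g)\in E$ ($x_g$ = location, $t_g$ = birth time). $\mathcal N$ is a Poisson point process on $E$ (viewed as a random locally finite set of germs) with intensity measure $\Lambda=\lambda^d\times m$, where $\lambda^d$ is Lebesgue measure on $\mathbb{R}^d$ and $m$ is a nonzero measure on $\mathbb{R}^+$ with $m([0,a])<\infty$ for all $a>0$. To each $g\in E$ is associated a (deterministic) function $A_g:\mathbb{R}^d\to\mathbb{R}^+$; the free crystal of $g$ at time $t\ge 0$ is $C_g(t)=\{x: A_g(x)\le t\}$. The random field is $\xi(x)=\inf_{g\in\mathcal N}A_g(x)$. The causal cone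 is $K_t=\{g\in E: A_g(0)\le t\}$ and $F(t)=\Lambda(K_t)$. The interior diameter $d_g(t)$ is the diameter of the greatest ball centered at $x_g$ and included in $C_g(t)$; the exterior diameter $D_g(t)$ is the diameter of the smallest ball centered at $x_g$ containing $C_g(t)$ (both are $0$ when $C_g(t)$ is empty, i.e. $t<t_g$). Assumptions. 1) For all $g=(x_g,t_g)\in E$ and $x\in\mathbb{R}^d$: $A_g(x)=A_{(0,t_g)}(x-x_g)$. 2) For all $g\in E$: $A_g(x_g)=t_g$ and $A_g(x)\ge t_g$ for all $x\in\mathbb{R}^d$. 3) The free crystals $C_g(t)$ are bounded convex sets, and $C_g(s)\subset C_g(t)$ for $0\le s<t$. 4) The functions $x\mapsto A_g(x)$ are continuous and $\partial C_g(t)=\{x: A_g(x)=t\}$. 5) There exists $M>0$ such that for all $t_g\in\mathbb{R}^+$ and $x\in\mathbb{R}^d$: $A_{(0,t_g)}(x)\ge t_g+\frac1M|x|$. 6) For all $g=(0,t_g)$ and all $r>0$ there exists $t>0$ with $C_g(t)\supset B(0,r)$. 7) With $L_g=\{(x,t): A_g(x)\le t\}$ the epigraph of $A_g$: for all $g\in E$ and all $g_1\in L_g$, $A_g(x)\le A_{g_1}(x)$ for all $x\in\mathbb{R}^d$. 8) There exists $A>0$ such that for all $g\in E$ and $t\in\mathbb{R}^+$: $\frac1A D_g(t)\le d_g(t)$. 9) For all $g=(x_g,t_g)\in E$, all $t\ge t_g$ and $h\ge0$: $D_g(t+h)\le D_g(t)+D_{(0,t)}(t+h)$. Absolute regularity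 coefficient. For disjoint $T_1,T_2\subset\mathbb{R}^d$, $\beta(T_1,T_2)=\|\mathcal P_{T_1\cup T_2}-\mathcal P_{T_1}\times\mathcal P_{T_2}\|_{var}$, where $\mathcal P_T$ is the distribution of the restriction $\xi_{|T}$ in the space $\mathcal C(T)$ of continuous real functions on $T$, $\mathcal C(T_1\cup T_2)$ is identified with $\mathcal C(T_1)\times\mathcal C(T_2)$, and $\|\cdot\|_{var}$ is the total variation norm (so $\|P-Q\|_{var}=2\sup_A|P(A)-Q(A)|$ for probability measures). *)

theory Defs
  imports "HOL-Probability.Probability"
begin

subsection \<open>Germs, free crystals and their diameters\<close>

text \<open>
  A germ is a pair of a location and a birth time. A family of crystals assigns to each germ \<open>g\<close>
  the function \<open>A g\<close>; only its values at germs of non-negative birth time are ever used.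
\<close>

type_synonym 'n germ = "(real ^ 'n) \<times> real"

definition germ_space :: "'n germ set" where
  "germ_space = UNIV \<times> {0..}"

definition free_crystal :: "('n germ \<Rightarrow> real ^ 'n \<Rightarrow> real) \<Rightarrow> 'n germ \<Rightarrow> real \<Rightarrow> (real ^ 'n) set" where
  "free_crystal A g t = {x. A g x \<le> t}"

text \<open>
  Balls are closed; twice the radius is the diameter of the ball. The least radius is well defined
  only for bounded crystals, and the greatest one only for crystals containing their own germ, which
  is why the empty crystal is treated separately.
\<close>

definition interior_diameter :: "('n::finite germ \<Rightarrow> real ^ 'n \<Rightarrow> real) \<Rightarrow> 'n germ \<Rightarrow> real \<Rightarrow> real" where
  "interior_diameter A g t =
     (if free_crystal A g t = {} then 0
      else 2 * Sup {\<rho>. 0 \<le> \<rho> \<and> cball (fst g) \<rho> \<subseteq> free_crystal A g t})"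

definition exterior_diameter :: "('n::finite germ \<Rightarrow> real ^ 'n \<Rightarrow> real) \<Rightarrow> 'n germ \<Rightarrow> real \<Rightarrow> real" where
  "exterior_diameter A g t =
     (if free_crystal A g t = {} then 0
      else 2 * Inf {\<rho>. 0 \<le> \<rho> \<and> free_crystal A g t \<subseteq> cball (fst g) \<rho>})"

definition epigraph_germs :: "('n germ \<Rightarrow> real ^ 'n \<Rightarrow> real) \<Rightarrow> 'n germ \<Rightarrow> 'n germ set" where
  "epigraph_germs A g = {(x, t). A g x \<le> t}"

locale crystal_family =
  fixes A :: "'n::finite germ \<Rightarrow> real ^ 'n \<Rightarrow> real" and M A0 :: real
  assumes nonneg: "\<And>g x. g \<in> germ_space \<Longrightarrow> 0 \<le> A g x"
    and homogeneous: "\<And>x\<^sub>g t\<^sub>g x. 0 \<le> t\<^sub>g \<Longrightarrow> A (x\<^sub>g, t\<^sub>g) x = A (0, t\<^sub>g) (x - x\<^sub>g)"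
    and birth: "\<And>x\<^sub>g t\<^sub>g. 0 \<le> t\<^sub>g \<Longrightarrow> A (x\<^sub>g, t\<^sub>g) x\<^sub>g = t\<^sub>g"
    and after_birth: "\<And>x\<^sub>g t\<^sub>g x. 0 \<le> t\<^sub>g \<Longrightarrow> t\<^sub>g \<le> A (x\<^sub>g, t\<^sub>g) x"
    and bounded_crystal: "\<And>g t. g \<in> germ_space \<Longrightarrow> 0 \<le> t \<Longrightarrow> bounded (free_crystal A g t)"
    and convex_crystal: "\<And>g t. g \<in> germ_space \<Longrightarrow> 0 \<le> t \<Longrightarrow> convex (free_crystal A g t)"
    and mono_crystal: "\<And>g s t. g \<in> germ_space \<Longrightarrow> 0 \<le> s \<Longrightarrow> s < t \<Longrightarrow>
          free_crystal A g s \<subseteq> free_crystal A g t"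
    and continuous: "\<And>g. g \<in> germ_space \<Longrightarrow> continuous_on UNIV (A g)"
    and frontier_crystal: "\<And>g t. g \<in> germ_space \<Longrightarrow> 0 \<le> t \<Longrightarrow>
          frontier (free_crystal A g t) = {x. A g x = t}"
    and M_pos: "0 < M"
    and bounded_speed: "\<And>t\<^sub>g x. 0 \<le> t\<^sub>g \<Longrightarrow> t\<^sub>g + 1 / M * norm x \<le> A (0, t\<^sub>g) x"
    and covers_balls: "\<And>t\<^sub>g r. 0 \<le> t\<^sub>g \<Longrightarrow> 0 < r \<Longrightarrow> \<exists>t>0. cball 0 r \<subseteq> free_crystal A (0, t\<^sub>g) t"
    and causality: "\<And>g g\<^sub>1 x. g \<in> germ_space \<Longrightarrow> g\<^sub>1 \<in> epigraph_germs A g \<Longrightarrow> A g x \<le> A g\<^sub>1 x"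
    and A0_pos: "0 < A0"
    and diameter_ratio: "\<And>g t. g \<in> germ_space \<Longrightarrow> 0 \<le> t \<Longrightarrow>
          1 / A0 * exterior_diameter A g t \<le> interior_diameter A g t"
    and diameter_growth: "\<And>x\<^sub>g t\<^sub>g t h. 0 \<le> t\<^sub>g \<Longrightarrow> t\<^sub>g \<le> t \<Longrightarrow> 0 \<le> h \<Longrightarrow>
          exterior_diameter A (x\<^sub>g, t\<^sub>g) (t + h) \<le>
            exterior_diameter A (x\<^sub>g, t\<^sub>g) t + exterior_diameter A (0, t) (t + h)"

definition causal_cone :: "('n germ \<Rightarrow> real ^ 'n \<Rightarrow> real) \<Rightarrow> real \<Rightarrow> 'n germ set" where
  "causal_cone A t = {g \<in> germ_space. A g 0 \<le> t}"

definition crystal_field :: "('n germ \<Rightarrow> real ^ 'n \<Rightarrow> real) \<Rightarrow> 'n germ set \<Rightarrow> real ^ 'n \<Rightarrow> real" where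
  "crystal_field A S x = (INF g\<in>S. A g x)"


subsection \<open>Poisson point processes\<close>

text \<open>
  The process is a random locally finite set of points of \<open>space \<Lambda>\<close>, without multiplicities: this
  loses nothing for intensity measures without atoms. As the intensity is finite on bounded sets,
  it suffices to prescribe the numbers of points in bounded measurable sets.
  The Poisson probabilities are written out because \<^const>\<open>poisson_pmf\<close> excludes the rate \<open>0\<close>.
\<close>

locale poisson_point_process = prob_space P
  for P :: "'w measure" and \<Lambda> :: "'a::metric_space measure" and N :: "'w \<Rightarrow> 'a set" +
  assumes points_in_space: "\<And>\<omega>. \<omega> \<in> space P \<Longrightarrow> N \<omega> \<subseteq> space \<Lambda>"
    and locally_finite: "\<And>\<omega> B. \<omega> \<in> space P \<Longrightarrow> bounded B \<Longrightarrow> finite (N \<omega> \<inter> B)"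
    and intensity_locally_finite: "\<And>B. B \<in> sets \<Lambda> \<Longrightarrow> bounded B \<Longrightarrow> emeasure \<Lambda> B < \<infinity>"
    and measurable_count: "\<And>B. B \<in> sets \<Lambda> \<Longrightarrow> bounded B \<Longrightarrow>
          (\<lambda>\<omega>. card (N \<omega> \<inter> B)) \<in> P \<rightarrow>\<^sub>M count_space UNIV"
    and poisson_count: "\<And>B k. B \<in> sets \<Lambda> \<Longrightarrow> bounded B \<Longrightarrow>
          prob {\<omega> \<in> space P. card (N \<omega> \<inter> B) = k} =
            measure \<Lambda> B ^ k / fact k * exp (- measure \<Lambda> B)"
    and independent_counts: "\<And>(n::nat) B. (\<And>i. i < n \<Longrightarrow> B i \<in> sets \<Lambda> \<and> bounded (B i)) \<Longrightarrow>
          disjoint_family_on B {..<n} \<Longrightarrow>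
          indep_vars (\<lambda>_. count_space UNIV) (\<lambda>i \<omega>. card (N \<omega> \<inter> B i)) {..<n}"


subsection \<open>Absolute regularity coefficient\<close>

text \<open>
  The total variation norm of the signed measure \<open>P - Q\<close>, for finite measures on the same
  \<open>\<sigma>\<close>-algebra.
\<close>

definition tv_norm :: "'a measure \<Rightarrow> 'a measure \<Rightarrow> ennreal" where
  "tv_norm P Q =
     (SUP \<A> \<in> {\<A>. finite \<A> \<and> \<A> \<subseteq> sets P \<and> disjoint \<A> \<and> \<Union>\<A> = space P}.
        ennreal (\<Sum>A\<in>\<A>. \<bar>measure P A - measure Q A\<bar>))"

lemma tv_norm_prob_space:
  assumes P: "prob_space P" and Q: "prob_space Q" and sets_eq: "sets P = sets Q"
  shows "tv_norm P Q = 2 * (SUP A\<in>sets P. ennreal \<bar>measure P A - measure Q A\<bar>)"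
proof -
  interpret P: prob_space P by fact
  interpret Q: prob_space Q by fact
  have space_eq: "space P = space Q"
    using sets_eq by (rule sets_eq_imp_space_eq)
  define S where "S = (SUP A\<in>sets P. ennreal \<bar>measure P A - measure Q A\<bar>)"
  let ?D = "\<lambda>A. measure P A - measure Q A"
  show ?thesis
    unfolding S_def[symmetric]
  proof (rule antisym)
    show "tv_norm P Q \<le> 2 * S"
      unfolding tv_norm_def
    proof (rule SUP_least)
      fix \<A> assume "\<A> \<in> {\<A>. finite \<A> \<and> \<A> \<subseteq> sets P \<and> disjoint \<A> \<and> \<Union>\<A> = space P}"
      then have fin: "finite \<A>" and sub: "\<A> \<subseteq> sets P" and disj: "disjoint \<A>" by auto
      have add: "?D (\<Union>\<B>) = (\<Sum>A\<in>\<B>. ?D A)" if "\<B> \<subseteq> \<A>" for \<B>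
      proof -
        have 1: "finite \<B>" "\<B> \<subseteq> sets P" using fin sub that finite_subset by blast+
        have 2: "disjoint_family_on (\<lambda>x. x) \<B>"
          using disj that by (auto simp: disjoint_def disjoint_family_on_def)
        show ?thesis
          using P.finite_measure_finite_Union[OF 1(1), of "\<lambda>x. x"]
            Q.finite_measure_finite_Union[OF 1(1), of "\<lambda>x. x"] 1 2 sets_eq
          by (simp add: sum_subtractf)
      qed
      define \<B> where "\<B> = {A\<in>\<A>. 0 \<le> ?D A}"
      define \<C> where "\<C> = {A\<in>\<A>. ?D A < 0}"
      have split: "\<A> = \<B> \<union> \<C>" "\<B> \<inter> \<C> = {}" "finite \<B>" "finite \<C>" "\<B> \<subseteq> \<A>" "\<C> \<subseteq> \<A>"
        using fin by (auto simp: \<B>_def \<C>_def)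
      have "(\<Sum>A\<in>\<A>. \<bar>?D A\<bar>) = (\<Sum>A\<in>\<B>. \<bar>?D A\<bar>) + (\<Sum>A\<in>\<C>. \<bar>?D A\<bar>)"
        unfolding split(1) by (rule sum.union_disjoint) (use split in auto)
      also have "(\<Sum>A\<in>\<B>. \<bar>?D A\<bar>) = (\<Sum>A\<in>\<B>. ?D A)"
        by (rule sum.cong) (auto simp: \<B>_def)
      also have "(\<Sum>A\<in>\<C>. \<bar>?D A\<bar>) = - (\<Sum>A\<in>\<C>. ?D A)"
        unfolding sum_negf[symmetric] by (rule sum.cong) (auto simp: \<C>_def)
      finally have le: "(\<Sum>A\<in>\<A>. \<bar>?D A\<bar>) \<le> \<bar>?D (\<Union>\<B>)\<bar> + \<bar>?D (\<Union>\<C>)\<bar>"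
        unfolding add[OF split(5), symmetric] add[OF split(6), symmetric] by linarith
      have S: "ennreal \<bar>?D (\<Union>\<X>)\<bar> \<le> S" if "\<X> \<subseteq> \<A>" for \<X>
        unfolding S_def
      proof (rule SUP_upper)
        have "finite \<X>" "\<X> \<subseteq> sets P" using that sub fin finite_subset by blast+
        then show "\<Union>\<X> \<in> sets P" by (rule sets.finite_Union)
      qed
      have "ennreal (\<Sum>A\<in>\<A>. \<bar>?D A\<bar>) \<le> ennreal (\<bar>?D (\<Union>\<B>)\<bar> + \<bar>?D (\<Union>\<C>)\<bar>)"
        using le by (rule ennreal_leI)
      also have "\<dots> = ennreal \<bar>?D (\<Union>\<B>)\<bar> + ennreal \<bar>?D (\<Union>\<C>)\<bar>"
        by (rule ennreal_plus) auto
      also have "\<dots> \<le> S + S"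
        by (intro add_mono S split)
      finally show "ennreal (\<Sum>A\<in>\<A>. \<bar>?D A\<bar>) \<le> 2 * S" by (simp add: mult_2)
    qed
    have "2 * ennreal \<bar>?D A\<bar> \<le> tv_norm P Q" if A: "A \<in> sets P" for A
    proof -
      have B: "space P - A \<in> sets P" using A by auto
      have ne: "A \<noteq> space P - A"
        using P.not_empty sets.sets_into_space[OF A] by blast
      have compl: "?D (space P - A) = - ?D A"
        using P.prob_compl[OF A] Q.prob_compl[of A] A sets_eq space_eq by simp
      have "2 * ennreal \<bar>?D A\<bar> = ennreal (\<bar>?D A\<bar> + \<bar>?D (space P - A)\<bar>)"
        unfolding compl by (simp add: mult_2)
      also have "\<bar>?D A\<bar> + \<bar>?D (space P - A)\<bar> = (\<Sum>B\<in>{A, space P - A}. \<bar>?D B\<bar>)"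
        using ne by (simp only: sum.insert finite.intros sum.empty insert_iff empty_iff simp_thms add_0_right)
      also have "\<dots> \<le> tv_norm P Q"
        unfolding tv_norm_def
        by (rule SUP_upper) (use A B sets.sets_into_space[OF A] in \<open>auto simp: disjoint_def\<close>)
      finally show ?thesis .
    qed
    then show "2 * S \<le> tv_norm P Q"
      unfolding S_def by (subst SUP_mult_left_ennreal) (auto intro: SUP_least)
  qed
qed

text \<open>
  The continuous real functions on \<open>T\<close> (extended by \<open>undefined\<close> outside of \<open>T\<close>), with the
  \<open>\<sigma>\<close>-algebra generated by the evaluations. On a closed subset of a Euclidean space, this is the
  Borel \<open>\<sigma>\<close>-algebra of the topology of uniform convergence on compact sets.
\<close>

definition continuous_functions :: "'a::topological_space set \<Rightarrow> ('a \<Rightarrow> real) measure" where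
  "continuous_functions T = restrict_space (\<Pi>\<^sub>M x\<in>T. borel) {f. continuous_on T f}"

definition restriction_law ::
    "'w measure \<Rightarrow> ('w \<Rightarrow> 'a::topological_space \<Rightarrow> real) \<Rightarrow> 'a set \<Rightarrow> ('a \<Rightarrow> real) measure" where
  "restriction_law P \<xi> T = distr P (continuous_functions T) (\<lambda>\<omega>. restrict (\<xi> \<omega>) T)"

text \<open>
  The image measure below is the law on \<open>T\<^sub>1 \<union> T\<^sub>2\<close> after identification of the functions on
  \<open>T\<^sub>1 \<union> T\<^sub>2\<close> with the pairs of functions on \<open>T\<^sub>1\<close> and \<open>T\<^sub>2\<close>, which is legitimate for disjoint closed
  sets.
\<close>

definition absolute_regularity ::
    "'w measure \<Rightarrow> ('w \<Rightarrow> 'a::topological_space \<Rightarrow> real) \<Rightarrow> 'a set \<Rightarrow> 'a set \<Rightarrow> ennreal" where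
  "absolute_regularity P \<xi> T\<^sub>1 T\<^sub>2 =
     tv_norm
       (distr (restriction_law P \<xi> (T\<^sub>1 \<union> T\<^sub>2)) (continuous_functions T\<^sub>1 \<Otimes>\<^sub>M continuous_functions T\<^sub>2)
          (\<lambda>f. (restrict f T\<^sub>1, restrict f T\<^sub>2)))
       (restriction_law P \<xi> T\<^sub>1 \<Otimes>\<^sub>M restriction_law P \<xi> T\<^sub>2)"

end

theory Submission
  imports Defs
begin

text \<open>
  The hyperplane \<open>\<langle>e, x\<rangle> = r\<close> splits the germs into two independent processes, whose fields \<open>\<eta>\<^sub>1\<close> and
  \<open>\<eta>\<^sub>2\<close> are compared with \<open>\<xi>\<close> on \<open>T\<^sub>1\<close> and \<open>T\<^sub>2\<close>. Cut \<open>T\<^sub>1\<close> into cubes of side proportional to \<open>r\<close>; at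
  most \<open>k\<^bsup>d-1\<^esup>\<close> of them are at lattice distance \<open>k - 1\<close> from the corner of \<open>T\<^sub>1\<close>. If the corner of such a
  cube is reached by some crystal before time \<open>C k\<close>, then the germ of that crystal lies on the side of
  \<open>T\<^sub>1\<close>, and the crystal covers the whole cube before any crystal of the other side arrives. Hence
  \<open>\<xi>\<close> and \<open>\<eta>\<^sub>1\<close> agree on \<open>T\<^sub>1\<close> outside of an event of probability at most \<open>S = \<Sum>k. k\<^bsup>d-1\<^esup> exp (- F (C k))\<close>, and
  the same holds on \<open>T\<^sub>2\<close>. Replacing \<open>\<xi>\<close> by \<open>\<eta>\<^sub>1\<close> and \<open>\<eta>\<^sub>2\<close>, in the joint law as well as in the product
  of the marginal laws, changes probabilities by at most \<open>2 S\<close> each time, which gives the bound \<open>8 S\<close>.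
\<close>

subsection \<open>Comparison of crystals\<close>


context crystal_family
begin

text \<open>A crystal reaches its own location at its birth, so the later germ lies in the epigraph
  of the earlier one and \<open>causality\<close> applies.\<close>

lemma arrival_mono_birth:
  assumes "0 \<le> s" "s \<le> s'"
  shows "A (y, s) x \<le> A (y, s') x"
proof (rule causality)
  show "(y, s) \<in> germ_space" using assms by (simp add: germ_space_def)
  show "(y, s') \<in> epigraph_germs A (y, s)"
    using assms birth[of s y] by (simp add: epigraph_germs_def)
qed

lemma distance_le_arrival:
  assumes "g \<in> germ_space"
  shows "norm (x - fst g) \<le> M * A g x"
proof -
  obtain y s where g: "g = (y, s)" "0 \<le> s"
    using assms by (cases g) (auto simp: germ_space_def)
  have "1 / M * norm (x - y) \<le> A (y, s) x"
    using bounded_speed[of s "x - y"] homogeneous[of s y x] g by simp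
  then show ?thesis
    using M_pos g by (simp add: field_simps)
qed

lemma location_in_crystal_iff:
  assumes "g \<in> germ_space"
  shows "fst g \<in> free_crystal A g t \<longleftrightarrow> snd g \<le> t"
  using assms birth[of "snd g" "fst g"] by (auto simp: free_crystal_def germ_space_def)

lemma norm_le_exterior_diameter:
  assumes g: "g \<in> germ_space" and x: "x \<in> free_crystal A g t"
  shows "2 * norm (x - fst g) \<le> exterior_diameter A g t"
proof -
  let ?S = "{\<rho>. 0 \<le> \<rho> \<and> free_crystal A g t \<subseteq> cball (fst g) \<rho>}"
  \<comment> \<open>A nonempty crystal forces a nonnegative time, as \<open>bounded_crystal\<close>
    requires; boundedness in turn makes \<open>?S\<close> nonempty, without which
    \<open>Inf ?S\<close> would be unspecified.\<close>
  have t: "0 \<le> t"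
    using x nonneg[OF g, of x] by (simp add: free_crystal_def)
  obtain \<rho> where "\<forall>y\<in>free_crystal A g t. dist (fst g) y \<le> \<rho>"
    using bounded_crystal[OF g t] unfolding bounded_any_center[where a = "fst g"] by blast
  then have "free_crystal A g t \<subseteq> cball (fst g) \<rho>" by auto
  moreover from this have "dist (fst g) x \<le> \<rho>"
    using x by auto
  then have "0 \<le> \<rho>"
    using zero_le_dist[of "fst g" x] by linarith
  ultimately have "?S \<noteq> {}" by blast
  then have "norm (x - fst g) \<le> Inf ?S"
    by (rule cInf_greatest) (use x in \<open>auto simp: dist_norm norm_minus_commute\<close>)
  then show ?thesis
    using x by (auto simp: exterior_diameter_def)
qed

lemma exterior_diameter_le:
  assumes "free_crystal A g t \<subseteq> cball (fst g) \<rho>" "0 \<le> \<rho>"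
  shows "exterior_diameter A g t \<le> 2 * \<rho>"
proof -
  have "Inf {\<rho>. 0 \<le> \<rho> \<and> free_crystal A g t \<subseteq> cball (fst g) \<rho>} \<le> \<rho>"
    by (rule cInf_lower) (use assms in \<open>auto intro: bdd_belowI[of _ 0]\<close>)
  then show ?thesis
    using assms by (auto simp: exterior_diameter_def)
qed

text \<open>The supremum of the radii need not be known to be attained; strictness leaves room for
  an admissible radius \<open>\<rho>'\<close> above \<open>\<rho>\<close>.\<close>

lemma cball_subset_crystal:
  assumes "fst g \<in> free_crystal A g t" "2 * \<rho> < interior_diameter A g t"
  shows "cball (fst g) \<rho> \<subseteq> free_crystal A g t"
proof -
  let ?S = "{\<rho>. 0 \<le> \<rho> \<and> cball (fst g) \<rho> \<subseteq> free_crystal A g t}"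
  have "free_crystal A g t \<noteq> {}"
    using assms(1) by blast
  then have "\<rho> < Sup ?S"
    using assms(2) by (simp add: interior_diameter_def)
  moreover have "0 \<in> ?S"
    using assms by simp
  then have "?S \<noteq> {}" by blast
  ultimately obtain \<rho>' where \<rho>': "cball (fst g) \<rho>' \<subseteq> free_crystal A g t" "\<rho> < \<rho>'"
    using less_cSupD[of ?S \<rho>] by blast
  then show ?thesis
    using subset_cball[of \<rho> \<rho>' "fst g"] by simp
qed


text \<open>Translate the germ to the origin and move its birth back to time \<open>0\<close>: by
  \<open>arrival_mono_birth\<close> this only enlarges the crystal.\<close>

lemma exterior_diameter_le_origin:
  assumes "0 \<le> s"
  shows "exterior_diameter A (y, s) t \<le> exterior_diameter A (0, 0) t"
proof (cases "free_crystal A (y, s) t = {}")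
  case True
  have "0 \<le> exterior_diameter A (0, 0) t"
  proof (cases "free_crystal A (0, 0) t = {}")
    case False
    then obtain x where "x \<in> free_crystal A (0, 0) t" by blast
    then have "2 * norm x \<le> exterior_diameter A (0, 0) t"
      using norm_le_exterior_diameter[of "(0, 0)" x t] by (simp add: germ_space_def)
    then show ?thesis
      using norm_ge_zero[of x] by linarith
  qed (simp add: exterior_diameter_def)
  then show ?thesis
    using True by (simp add: exterior_diameter_def)
next
  case False
  let ?r = "exterior_diameter A (0, 0) t / 2"
  have *: "norm (x - y) \<le> ?r" if "x \<in> free_crystal A (y, s) t" for x
  proof -
    have "A (0, 0) (x - y) \<le> A (0, s) (x - y)"
      using assms by (intro arrival_mono_birth) auto
    also have "\<dots> \<le> t"
      using that assms homogeneous[of s y x] by (simp add: free_crystal_def)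
    finally show ?thesis
      using norm_le_exterior_diameter[of "(0, 0)" "x - y" t]
      by (simp add: free_crystal_def germ_space_def)
  qed
  have "exterior_diameter A (y, s) t \<le> 2 * ?r"
  proof (rule exterior_diameter_le)
    show "free_crystal A (y, s) t \<subseteq> cball (fst (y, s)) ?r"
      using * by (auto simp: dist_norm norm_minus_commute)
    obtain x where "x \<in> free_crystal A (y, s) t"
      using False by blast
    then show "0 \<le> ?r"
      by (rule order_trans[OF norm_ge_zero *])
  qed
  then show ?thesis by simp
qed

lemma exterior_diameter_origin_le:
  assumes "0 \<le> t"
  shows "exterior_diameter A (0, 0) t \<le> 2 * (M * t)"
proof (rule exterior_diameter_le)
  show "0 \<le> M * t"
    using assms M_pos by simp
  show "free_crystal A (0, 0) t \<subseteq> cball (fst (0, 0)) (M * t)"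
  proof
    fix x assume x: "x \<in> free_crystal A (0, 0) t"
    have "norm x \<le> M * A (0, 0) x"
      using distance_le_arrival[of "(0, 0)" x] by (simp add: germ_space_def)
    also have "\<dots> \<le> M * t"
      using x M_pos by (simp add: free_crystal_def)
    finally show "x \<in> cball (fst (0, 0)) (M * t)" by simp
  qed
qed

text \<open>
  There is no lower bound on the speed of the crystals, so the two fronts are compared on the clock
  \<open>exterior_diameter A (0, 0)\<close>: by this clock no crystal grows faster than the crystal of \<open>(0, 0)\<close>,
  and by \<open>diameter_growth\<close> and \<open>diameter_ratio\<close> none is more than \<open>A0\<close> times slower.
\<close>

lemma arrival_le_of_early_hit:
  assumes g: "g \<in> germ_space" and hit: "A g z \<le> t"
    and g': "g' \<in> germ_space" and far: "A0 * norm (x - z) < norm (x - fst g') - M * t"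
  shows "A g x \<le> A g' x"
proof -
  define \<tau> where "\<tau> = A g' x"
  let ?U = "exterior_diameter A (0, 0)"
  have t: "0 \<le> t"
    using nonneg[OF g, of z] hit by simp
  have \<tau>: "2 * norm (x - fst g') \<le> ?U \<tau>"
  proof -
    have "2 * norm (x - fst g') \<le> exterior_diameter A g' \<tau>"
      using g' by (rule norm_le_exterior_diameter) (simp add: free_crystal_def \<tau>_def)
    also have "\<dots> \<le> ?U \<tau>"
      using exterior_diameter_le_origin[of "snd g'" "fst g'" \<tau>] g' by (auto simp: germ_space_def)
    finally show ?thesis .
  qed
  have "t \<le> \<tau>"
  proof -
    have "norm (x - fst g') \<le> M * \<tau>"
      unfolding \<tau>_def using g' by (rule distance_le_arrival)
    moreover have "0 \<le> A0 * norm (x - z)"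
      using A0_pos by simp
    ultimately have "M * t < M * \<tau>"
      using far by linarith
    then show ?thesis
      using M_pos by simp
  qed
  have growth: "?U \<tau> \<le> ?U t + exterior_diameter A (0, t) \<tau>"
    using diameter_growth[of 0 t "\<tau> - t" 0] t \<open>t \<le> \<tau>\<close> by simp
  have shift: "A (z, t) y = A (0, t) (y - z)" for y
    using homogeneous[OF t] .
  \<comment> \<open>By \<open>growth\<close>, \<open>?U \<tau>\<close> splits into a part gained up
    to time \<open>t\<close>, at most \<open>2 * (M * t)\<close>, and the diameter of the crystal of
    \<open>(0, t)\<close> at time \<open>\<tau>\<close>. As \<open>?U \<tau>\<close> is at least
    \<open>2 * norm (x - fst g')\<close>, \<open>far\<close> bounds the second part from
    below.\<close>
  have "A0 * (2 * norm (x - z)) < exterior_diameter A (0, t) \<tau>"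
    using far \<tau> growth exterior_diameter_origin_le[OF t] by (simp add: algebra_simps)
  also have "\<dots> \<le> A0 * interior_diameter A (0, t) \<tau>"
    using diameter_ratio[of "(0, t)" \<tau>] t \<open>t \<le> \<tau>\<close> A0_pos by (simp add: germ_space_def field_simps)
  finally have "2 * norm (x - z) < interior_diameter A (0, t) \<tau>"
    using A0_pos by simp
  moreover have "fst (0, t) \<in> free_crystal A (0, t) \<tau>"
    using location_in_crystal_iff[of "(0, t)" \<tau>] t \<open>t \<le> \<tau>\<close> by (simp add: germ_space_def)
  ultimately have "cball (fst (0, t)) (norm (x - z)) \<subseteq> free_crystal A (0, t) \<tau>"
    by (intro cball_subset_crystal)
  then have "A (0, t) (x - z) \<le> \<tau>"
    by (auto simp: free_crystal_def subset_iff)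
  \<comment> \<open>The crystal of \<open>g\<close> holds \<open>z\<close> at time \<open>t\<close>,
    so it stays ahead of a crystal born there and then; the latter is a translate of the crystal of
    \<open>(0, t)\<close> just estimated.\<close>
  moreover have "A g x \<le> A (z, t) x"
    by (rule causality[OF g]) (simp add: epigraph_germs_def hit)
  ultimately show ?thesis
    using shift[of x] by (simp add: \<tau>_def)
qed

text \<open>An inscribed centered ball is no larger than a circumscribed one, so
  \<open>diameter_ratio\<close> for a crystal of positive diameter forces the claim.\<close>

lemma A0_ge_1: "1 \<le> A0"
proof -
  obtain t where t: "0 < t" "cball 0 1 \<subseteq> free_crystal A (0, 0) t"
    using covers_balls[of 0 1] by auto
  obtain i :: 'n where True by blast
  have "(axis i 1 :: real ^ 'n) \<in> free_crystal A (0, 0) t"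
    using t by (auto simp: subset_iff)
  then have D: "0 < exterior_diameter A (0, 0) t"
    using norm_le_exterior_diameter[of "(0, 0)" "(axis i 1 :: real ^ 'n)" t] by (simp add: germ_space_def)
  have "interior_diameter A (0, 0) t \<le> exterior_diameter A (0, 0) t"
  proof (rule ccontr)
    assume *: "\<not> ?thesis"
    \<comment> \<open>Half the mean of the two diameters lies strictly between the two radii: the
      ball of radius \<open>\<rho>\<close> would be inside the crystal and yet have a point too far
      from the germ.\<close>
    define \<rho> where "\<rho> = (exterior_diameter A (0, 0) t + interior_diameter A (0, 0) t) / 4"
    have "cball 0 \<rho> \<subseteq> free_crystal A (0, 0) t"
      using * location_in_crystal_iff[of "(0, 0)" t] t cball_subset_crystal[of "(0, 0)" t \<rho>]
      by (simp add: \<rho>_def germ_space_def)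
    moreover have "\<rho> *\<^sub>R (axis i 1 :: real ^ 'n) \<in> cball 0 \<rho>"
      using * D by (simp add: \<rho>_def dist_norm)
    ultimately have "\<rho> *\<^sub>R (axis i 1 :: real ^ 'n) \<in> free_crystal A (0, 0) t"
      by blast
    then have "2 * norm (\<rho> *\<^sub>R (axis i 1 :: real ^ 'n)) \<le> exterior_diameter A (0, 0) t"
      using norm_le_exterior_diameter[of "(0, 0)" "\<rho> *\<^sub>R (axis i 1)" t]
      by (simp add: germ_space_def del: norm_scaleR)
    then show False
      using * D by (simp add: \<rho>_def)
  qed
  then have "1 / A0 * exterior_diameter A (0, 0) t \<le> exterior_diameter A (0, 0) t"
    using diameter_ratio[of "(0, 0)" t] t by (simp add: germ_space_def)
  then show ?thesis
    using D A0_pos by (simp add: field_simps)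
qed

end


subsection \<open>Cells of an orthant\<close>


text \<open>The values off one fixed coordinate \<open>i\<close> determine the function, since the
  sum gives the value at \<open>i\<close>; each of these \<open>CARD('n) - 1\<close> values is at
  most \<open>j\<close>.\<close>

lemma finite_functions_with_sum:
  "finite {n :: 'n::finite \<Rightarrow> nat. sum n UNIV = j}"
  and card_functions_with_sum_le:
  "card {n :: 'n::finite \<Rightarrow> nat. sum n UNIV = j} \<le> Suc j ^ (CARD('n) - 1)"
proof -
  let ?X = "{n :: 'n \<Rightarrow> nat. sum n UNIV = j}"
  obtain i :: 'n where True by blast
  let ?Y = "PiE (UNIV - {i}) (\<lambda>_. {..j})"
  let ?res = "\<lambda>n. restrict n (UNIV - {i})"
  have Y: "finite ?Y" "card ?Y = Suc j ^ (CARD('n) - 1)"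
    by (auto simp: card_PiE intro!: finite_PiE)
  have inj: "inj_on ?res ?X"
  proof (rule inj_onI)
    fix n n' assume n: "n \<in> ?X" and n': "n' \<in> ?X" and eq: "?res n = ?res n'"
    have off: "n k = n' k" if "k \<noteq> i" for k
      using fun_cong[OF eq, of k] that by simp
    have "sum n (UNIV - {i}) = sum n' (UNIV - {i})"
      by (rule sum.cong) (auto intro: off)
    moreover have "n i + sum n (UNIV - {i}) = n' i + sum n' (UNIV - {i})"
      using n n' by (simp flip: sum.remove)
    ultimately have "n i = n' i" by simp
    then show "n = n'"
      using off by (metis ext)
  qed
  have sub: "?res ` ?X \<subseteq> ?Y"
  proof -
    have "n k \<le> j" if "n \<in> ?X" for n :: "'n \<Rightarrow> nat" and k
      using that member_le_sum[of k UNIV n] by simp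
    then show ?thesis
      by (auto simp: restrict_def PiE_def extensional_def split: if_splits)
  qed
  show "finite ?X"
    using inj_on_finite[OF inj sub] Y by blast
  show "card ?X \<le> Suc j ^ (CARD('n) - 1)"
    using card_inj_on_le[OF inj sub] Y by simp
qed

text \<open>
  The sign \<open>\<sigma>\<close> selects the orthant with apex \<open>b\<close>, so that \<open>T\<^sub>1\<close> and \<open>T\<^sub>2\<close> are treated at the same time.
\<close>

definition lattice_corner :: "real \<Rightarrow> real \<Rightarrow> real ^ 'n \<Rightarrow> ('n::finite \<Rightarrow> nat) \<Rightarrow> real ^ 'n" where
  "lattice_corner \<sigma> s b n = (\<chi> i. b $ i - \<sigma> * (s * real (n i)))"

lemma norm_le_sqrt_card:
  fixes x :: "real ^ 'n::finite"
  assumes "\<And>i. \<bar>x $ i\<bar> \<le> s"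
  shows "norm x \<le> s * sqrt (real CARD('n))"
proof -
  have s: "0 \<le> s"
    using assms abs_ge_zero order_trans by blast
  have "inner x x \<le> (\<Sum>i\<in>(UNIV :: 'n set). s\<^sup>2)"
    unfolding inner_vec_def
  proof (rule sum_mono)
    fix i
    have "\<bar>x $ i\<bar>\<^sup>2 \<le> s\<^sup>2"
      using assms by (intro power_mono) auto
    then show "inner (x $ i) (x $ i) \<le> s\<^sup>2"
      by (simp add: power2_eq_square)
  qed
  then have "norm x \<le> sqrt (real CARD('n) * s\<^sup>2)"
    by (simp add: norm_eq_sqrt_inner)
  then show ?thesis
    using s by (simp add: real_sqrt_mult mult.commute)
qed

text \<open>The unit normal of the separating hyperplane, which the theorem calls
  \<open>e\<close>.\<close>

definition diagonal :: "real ^ 'n::finite" where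
  "diagonal = (1 / sqrt (real CARD('n))) *\<^sub>R (\<chi> i. 1)"

lemma inner_diagonal: "inner diagonal x = (\<Sum>i\<in>UNIV. x $ i) / sqrt (real CARD('n))"
  for x :: "real ^ 'n::finite"
  by (simp add: diagonal_def inner_vec_def sum_distrib_left sum_divide_distrib)

lemma norm_diagonal: "norm (diagonal :: real ^ 'n::finite) = 1"
  by (simp add: norm_eq_sqrt_inner inner_diagonal) (simp add: diagonal_def real_div_sqrt)

context crystal_family
begin

text \<open>
  The side \<open>s\<close> balances two requirements: \<open>A0\<close> times the diameter of a cell stays below \<open>r - M C\<close>, and from
  one layer of cells to the next the distance \<open>s / sqrt d\<close> to the hyperplane grows faster than \<open>M C\<close>.
\<close>

lemma crystal_field_eq_of_hits:
  fixes b :: "real ^ 'n" and \<sigma> r C s :: real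
  assumes \<sigma>: "\<bar>\<sigma>\<bar> = 1" and r: "0 < r" and C: "8 * A0 * real CARD('n) * (M * C) \<le> r"
    and s: "s = 3 * r / (4 * A0 * sqrt (real CARD('n)))"
    and S: "S \<subseteq> germ_space"
    and W: "\<And>g. g \<in> germ_space \<Longrightarrow> \<sigma> * inner diagonal (fst g - b) < r \<Longrightarrow> g \<in> W"
    and hits: "\<And>n. \<exists>g\<in>S. A g (lattice_corner \<sigma> s b n) \<le> C * real (Suc (sum n UNIV))"
    and x: "\<And>i. \<sigma> * (x $ i - b $ i) \<le> 0"
  shows "crystal_field A S x = crystal_field A (S \<inter> W) x"
proof -
  let ?d = "real CARD('n)"
  \<comment> \<open>The common unit of all lengths below: \<open>M * C\<close> is at most
    \<open>q\<close>, consecutive layers of corners are \<open>6 * q\<close> apart along the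
    diagonal, \<open>A0\<close> times the diameter of a cell is \<open>6 * (A0 * ?d) * q\<close>,
    and \<open>r\<close> is \<open>8 * (A0 * ?d) * q\<close>.\<close>
  define q where "q = r / (8 * A0 * ?d)"
  have d: "1 \<le> ?d"
    using zero_less_card_finite[where 'a='n] by linarith
  have A0d: "1 \<le> A0 * ?d"
    using A0_ge_1 d mult_mono[of 1 A0 1 ?d] by simp
  have q: "0 < q" "r = 8 * (A0 * ?d) * q" "M * C \<le> q"
    using r C A0_pos d by (auto simp: q_def field_simps)
  have s_pos: "0 < s"
    using r A0_pos d by (simp add: s)
  have s_slope: "s / sqrt ?d = 6 * q"
    using A0_pos d by (simp add: s q_def field_simps)
  have s_diam: "A0 * (s * sqrt ?d) = 6 * (A0 * ?d) * q"
    using A0_pos d by (simp add: s q_def field_simps)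
  \<comment> \<open>\<open>n\<close> indexes the cell of \<open>x\<close>, and \<open>z\<close> is
    the corner of that cell nearest to the apex \<open>b\<close>. The floors are nonnegative by
    \<open>x\<close>, so \<open>nat\<close> loses nothing.\<close>
  define n where "n i = nat \<lfloor>\<sigma> * (b $ i - x $ i) / s\<rfloor>" for i
  define k where "k = sum n UNIV"
  define z where "z = lattice_corner \<sigma> s b n"
  have \<sigma>2: "\<sigma> * \<sigma> = 1"
    using \<sigma> by (metis abs_mult_self_eq mult_1)
  have n: "s * real (n i) \<le> \<sigma> * (b $ i - x $ i)" "\<sigma> * (b $ i - x $ i) \<le> s * real (n i) + s" for i
  proof -
    let ?y = "\<sigma> * (b $ i - x $ i) / s"
    have "0 \<le> ?y"
      using x[of i] s_pos by (simp add: algebra_simps)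
    then have "real (n i) \<le> ?y" "?y \<le> real (n i) + 1"
      unfolding n_def by linarith+
    then show "s * real (n i) \<le> \<sigma> * (b $ i - x $ i)" "\<sigma> * (b $ i - x $ i) \<le> s * real (n i) + s"
      using s_pos by (simp_all add: field_simps)
  qed
  have near: "norm (x - z) \<le> s * sqrt ?d"
  proof (rule norm_le_sqrt_card)
    fix i
    have "\<bar>(x - z) $ i\<bar> = \<bar>\<sigma>\<bar> * \<bar>(x - z) $ i\<bar>"
      using \<sigma> by simp
    also have "\<dots> = \<bar>\<sigma> * (x $ i - b $ i) + \<sigma> * \<sigma> * (s * real (n i))\<bar>"
      by (simp add: z_def lattice_corner_def algebra_simps flip: abs_mult)
    also have "\<dots> \<le> s"
      using n[of i] unfolding \<sigma>2 by (simp add: algebra_simps abs_le_iff)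
    finally show "\<bar>(x - z) $ i\<bar> \<le> s" .
  qed
  have inner_z: "\<sigma> * inner diagonal (z - b) = - (6 * q) * real k"
  proof -
    have "\<sigma> * (\<Sum>i\<in>UNIV. (z - b) $ i) = (\<Sum>i\<in>UNIV. - (\<sigma> * \<sigma>) * (s * real (n i)))"
      unfolding sum_distrib_left by (rule sum.cong) (auto simp: z_def lattice_corner_def algebra_simps)
    also have "\<dots> = - (s * real k)"
      by (simp add: \<sigma>2 k_def sum_negf sum_distrib_left)
    finally show ?thesis
      by (simp add: inner_diagonal flip: s_slope)
  qed
  have inner_x: "\<sigma> * inner diagonal (x - b) \<le> - (6 * q) * real k"
  proof -
    have "\<sigma> * (\<Sum>i\<in>UNIV. (x - b) $ i) \<le> (\<Sum>i\<in>UNIV. - (s * real (n i)))"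
      unfolding sum_distrib_left using n by (intro sum_mono) (simp add: algebra_simps)
    also have "\<dots> = - (s * real k)"
      by (simp add: k_def sum_negf sum_distrib_left)
    finally have "\<sigma> * (\<Sum>i\<in>UNIV. (x - b) $ i) / sqrt ?d \<le> - (s * real k) / sqrt ?d"
      by (rule divide_right_mono) simp
    then show ?thesis
      by (simp add: inner_diagonal flip: s_slope)
  qed
  have inner_le: "\<sigma> * inner diagonal v \<le> norm v" for v :: "real ^ 'n"
  proof -
    have "\<bar>\<sigma> * inner diagonal v\<bar> \<le> norm v"
      using Cauchy_Schwarz_ineq2[of diagonal v] \<sigma> by (simp add: abs_mult norm_diagonal)
    then show ?thesis by linarith
  qed
  obtain g where g: "g \<in> S" "A g z \<le> C * real (Suc k)"
    using hits unfolding z_def k_def by blast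
  have MC: "M * (C * real (Suc k)) \<le> q * real (Suc k)"
    using mult_right_mono[OF q(3), of "real (Suc k)"] by (simp add: mult.assoc)
  \<comment> \<open>The germ lies within \<open>q * real (Suc k)\<close> of \<open>z\<close>, which
    is \<open>6 * q * real k\<close> behind the apex; hence it is at most \<open>q\<close> beyond
    the apex, short of the hyperplane at \<open>r\<close>.\<close>
  have "g \<in> W"
  proof (rule W)
    show "g \<in> germ_space"
      using g S by blast
    have "norm (fst g - z) \<le> M * A g z"
      using distance_le_arrival[of g z] g S by (auto simp: norm_minus_commute)
    also have "\<dots> \<le> M * (C * real (Suc k))"
      using g M_pos by simp
    finally have "\<sigma> * inner diagonal (fst g - z) \<le> q * real (Suc k)"
      using MC inner_le[of "fst g - z"] by linarith
    moreover have "\<sigma> * inner diagonal (fst g - b) =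
        \<sigma> * inner diagonal (fst g - z) + \<sigma> * inner diagonal (z - b)"
      by (simp add: inner_diff_right algebra_simps)
    moreover have "q < r"
      using q(1) A0d mult_right_mono[OF A0d, of q] unfolding q(2) by linarith
    moreover have "0 \<le> q * real k"
      using q by simp
    ultimately show "\<sigma> * inner diagonal (fst g - b) < r"
      unfolding inner_z by (simp add: algebra_simps)
  qed
  \<comment> \<open>A germ outside \<open>W\<close> is at least \<open>r + 6 * q * real k\<close>
    away from \<open>x\<close>. After subtracting the head start, at most
    \<open>q + q * real k\<close>, more than \<open>6 * (A0 * ?d) * q\<close> remains, which
    suffices for \<open>arrival_le_of_early_hit\<close>.\<close>
  have faster: "A g x \<le> A g' x" if g': "g' \<in> S" "g' \<notin> W" for g'
  proof (rule arrival_le_of_early_hit)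
    show "g \<in> germ_space" "g' \<in> germ_space" "A g z \<le> C * real (Suc k)"
      using g g' S by auto
    have "r \<le> \<sigma> * inner diagonal (fst g' - b)"
      using W[of g'] g' S by force
    moreover have "\<sigma> * inner diagonal (fst g' - x) =
        \<sigma> * inner diagonal (fst g' - b) - \<sigma> * inner diagonal (x - b)"
      by (simp add: inner_diff_right algebra_simps)
    ultimately have "r + 6 * q * real k \<le> norm (x - fst g')"
      using inner_le[of "fst g' - x"] inner_x by (simp add: norm_minus_commute)
    moreover have "A0 * norm (x - z) \<le> 6 * (A0 * ?d) * q"
      unfolding s_diam[symmetric] using near A0_pos by simp
    moreover have "0 \<le> q * real k"
      using q by simp
    moreover have "q \<le> A0 * ?d * q"
      using mult_right_mono[OF A0d, of q] q by simp
    moreover have "M * (C * real (Suc k)) \<le> q + q * real k"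
      using MC by (simp add: algebra_simps)
    ultimately show "A0 * norm (x - z) < norm (x - fst g') - M * (C * real (Suc k))"
      using q(1,2) by linarith
  qed
  have bdd: "bdd_below ((\<lambda>g. A g x) ` S)"
    using S nonneg by (auto intro!: bdd_belowI[of _ 0])
  \<comment> \<open>Germs outside \<open>W\<close> lose to \<open>g\<close>, which also keeps
    \<open>S \<inter> W\<close> nonempty, so that its infimum is a genuine one.\<close>
  have "(INF g\<in>S \<inter> W. A g x) \<le> A g' x" if "g' \<in> S" for g'
  proof (cases "g' \<in> W")
    case True
    then show ?thesis
      using that bdd by (intro cINF_lower) (auto intro: bdd_below_mono)
  next
    case False
    have "(INF g\<in>S \<inter> W. A g x) \<le> A g x"
      using g \<open>g \<in> W\<close> bdd by (intro cINF_lower) (auto intro: bdd_below_mono)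
    then show ?thesis
      using faster[OF that False] by linarith
  qed
  then show ?thesis
    unfolding crystal_field_def
    using g \<open>g \<in> W\<close> bdd by (intro antisym cINF_greatest cINF_superset_mono) auto
qed

end


subsection \<open>Measurability and independence\<close>


text \<open>The indicator of the complement is monotone, hence Borel.\<close>

lemma down_closed_set_borel:
  fixes S :: "real set"
  assumes "\<And>s t. t \<in> S \<Longrightarrow> s \<le> t \<Longrightarrow> s \<in> S"
  shows "S \<in> sets borel"
proof -
  have "mono (\<lambda>x. if x \<in> S then 0 else 1 :: real)"
    using assms by (auto simp: mono_def)
  then have "(\<lambda>x. if x \<in> S then 0 else 1 :: real) \<in> borel_measurable borel"
    by (rule borel_measurable_mono)
  then have "(\<lambda>x. if x \<in> S then 0 else 1 :: real) -` {0} \<inter> space borel \<in> sets borel"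
    by (rule measurable_sets) simp
  moreover have "(\<lambda>x. if x \<in> S then 0 else 1 :: real) -` {0} \<inter> space borel = S"
    by auto
  ultimately show ?thesis by simp
qed

section \<open>Early germs and continuity of the field\<close>

context crystal_family
begin

text \<open>The axioms of the Poisson process speak of bounded sets only; the bounded speed and the
  nonnegative birth times put the early germs within their scope.\<close>

lemma bounded_early_germs: "bounded {g \<in> germ_space. A g x \<le> t}"
proof (rule bounded_subset)
  show "bounded (cball x (M * t) \<times> {0..t})"
    by (intro bounded_Times) auto
  show "{g \<in> germ_space. A g x \<le> t} \<subseteq> cball x (M * t) \<times> {0..t}"
  proof
    fix g assume g: "g \<in> {g \<in> germ_space. A g x \<le> t}"
    have "norm (x - fst g) \<le> M * A g x" "M * A g x \<le> M * t"
      using distance_le_arrival[of g x] g M_pos by auto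
    moreover have "snd g \<le> A g x" "0 \<le> snd g"
      using g after_birth[of "snd g" "fst g" x] by (auto simp: germ_space_def)
    ultimately show "g \<in> cball x (M * t) \<times> {0..t}"
      using g by (cases g) (auto simp: dist_norm)
  qed
qed

text \<open>Near \<open>x\<close> the field is a minimum of finitely many continuous functions. One
  germ \<open>g\<^sub>0\<close> covers the unit ball around \<open>x\<close> by some time
  \<open>K\<close>, so only germs reaching this ball by time \<open>K\<close> compete, and these
  form a bounded set.\<close>

lemma continuous_on_crystal_field:
  assumes S: "S \<subseteq> germ_space" and fin: "\<And>B. bounded B \<Longrightarrow> finite (S \<inter> B)"
  shows "continuous_on UNIV (crystal_field A S)"
proof (cases "S = {}")
  case True
  then show ?thesis by (simp add: crystal_field_def)
next
  case False
  then obtain g\<^sub>0 where g\<^sub>0: "g\<^sub>0 \<in> S" by blast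
  have cont: "continuous_on X (A g)" if "g \<in> S" for g X
    using continuous_on_subset[OF continuous[of g]] that S by blast
  have "isCont (crystal_field A S) x" for x
  proof -
    have "bdd_above (A g\<^sub>0 ` cball x 1)"
      using g\<^sub>0 by (intro bounded_imp_bdd_above compact_imp_bounded compact_continuous_image cont) auto
    then obtain K where "\<forall>y\<in>cball x 1. A g\<^sub>0 y \<le> K"
      unfolding bdd_above_def ball_simps by blast
    then have K: "A g\<^sub>0 y \<le> K" if "y \<in> cball x 1" for y
      using that by blast
    define G where "G = {g \<in> S. \<exists>y\<in>cball x 1. A g y \<le> K}"
    have "bounded (cball x (1 + M * K) \<times> {0..K})"
      by (intro bounded_Times) auto
    from fin[OF this] have "finite (S \<inter> cball x (1 + M * K) \<times> {0..K})" .
    moreover have "G \<subseteq> S \<inter> cball x (1 + M * K) \<times> {0..K}"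
    proof
      fix g assume g: "g \<in> G"
      then obtain y where y: "y \<in> cball x 1" "A g y \<le> K" by (auto simp: G_def)
      have gs: "g \<in> germ_space" using g S by (auto simp: G_def)
      have "norm (y - fst g) \<le> M * A g y" "M * A g y \<le> M * K"
        using distance_le_arrival[OF gs, of y] y M_pos by auto
      moreover have "dist x (fst g) \<le> dist x y + norm (y - fst g)"
        using dist_triangle[of x "fst g" y] by (simp add: dist_norm)
      moreover have "snd g \<le> A g y" "0 \<le> snd g"
        using gs after_birth[of "snd g" "fst g" y] by (auto simp: germ_space_def)
      ultimately show "g \<in> S \<inter> cball x (1 + M * K) \<times> {0..K}"
        using g y by (cases g) (auto simp: G_def)
    qed
    ultimately have G: "finite G"
      by (rule finite_subset[rotated])
    have g\<^sub>0G: "g\<^sub>0 \<in> G"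
      using g\<^sub>0 K[of x] by (auto simp: G_def intro!: bexI[of _ x])
    have bdd: "bdd_below ((\<lambda>g. A g y) ` S)" for y
      using S nonneg by (auto intro!: bdd_belowI[of _ 0])
    have eq: "crystal_field A S y = Min ((\<lambda>g. A g y) ` G)" if y: "y \<in> ball x 1" for y
    proof -
      have "Min ((\<lambda>g. A g y) ` G) \<le> A g y" if "g \<in> S" for g
      proof (cases "g \<in> G")
        case False
        then have "K < A g y"
          using that y by (auto simp: G_def not_le less_imp_le)
        moreover have "Min ((\<lambda>g. A g y) ` G) \<le> A g\<^sub>0 y"
          using G g\<^sub>0G by simp
        ultimately show ?thesis
          using K[of y] y by auto
      qed (use G in simp)
      then have "Min ((\<lambda>g. A g y) ` G) \<le> (INF g\<in>S. A g y)"
        using g\<^sub>0 by (intro cINF_greatest) auto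
      moreover have "(INF g\<in>S. A g y) \<le> Min ((\<lambda>g. A g y) ` G)"
        using G g\<^sub>0G bdd[of y] by (auto simp: G_def intro!: Min.boundedI cINF_lower)
      ultimately show ?thesis
        by (simp add: crystal_field_def)
    qed
    have "finite X \<Longrightarrow> X \<noteq> {} \<Longrightarrow> X \<subseteq> S \<Longrightarrow> continuous_on UNIV (\<lambda>y. Min ((\<lambda>g. A g y) ` X))" for X
    proof (induction X rule: finite_ne_induct)
      case (insert g X)
      have "(\<lambda>y. Min ((\<lambda>g. A g y) ` insert g X)) = (\<lambda>y. min (A g y) (Min ((\<lambda>g. A g y) ` X)))"
        using insert by simp
      then show ?case
        using insert by (auto intro!: continuous_on_min cont)
    qed (auto intro: cont)
    moreover have "G \<noteq> {}" "G \<subseteq> S"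
      using g\<^sub>0G by (blast, simp add: G_def)
    ultimately have "continuous_on UNIV (\<lambda>y. Min ((\<lambda>g. A g y) ` G))"
      using G by blast
    then have "continuous_on (ball x 1) (\<lambda>y. Min ((\<lambda>g. A g y) ` G))"
      by (rule continuous_on_subset) simp
    then have "continuous_on (ball x 1) (crystal_field A S)"
      by (subst continuous_on_cong[OF refl eq])
    then show ?thesis
      by (simp add: continuous_on_eq_continuous_at)
  qed
  then show ?thesis
    by (simp add: continuous_at_imp_continuous_on)
qed

end

section \<open>Germs of a Poisson process: arrival times, void events, independence\<close>

locale crystal_process =
  crystal_family A M A0 + poisson_point_process P \<Lambda> N
  for A :: "'n::finite germ \<Rightarrow> real ^ 'n \<Rightarrow> real" and M A0 :: real
    and P :: "'w measure" and \<Lambda> :: "'n germ measure" and N :: "'w \<Rightarrow> 'n germ set" +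
  fixes m :: "real measure"
  assumes sets_m: "sets m = sets (restrict_space borel {0..})"
    and m_finite: "\<And>s. 0 < s \<Longrightarrow> emeasure m {0..s} < \<infinity>"
    and \<Lambda>_eq: "\<Lambda> = lborel \<Otimes>\<^sub>M m"
begin

lemma space_m: "space m = {0..}"
  using sets_eq_imp_space_eq[OF sets_m] by simp

lemma space_\<Lambda>: "space \<Lambda> = germ_space"
  by (simp add: \<Lambda>_eq space_pair_measure space_m germ_space_def)

lemma sets_m_Int: "S \<in> sets borel \<Longrightarrow> S \<inter> {0..} \<in> sets m"
  by (auto simp: sets_m sets_restrict_space)

lemma points_germs: "\<omega> \<in> space P \<Longrightarrow> N \<omega> \<subseteq> germ_space"
  using points_in_space by (simp add: space_\<Lambda>)

text \<open>Arrival times are continuous in the location but merely monotone in the birth time.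
  Still, the germs arriving before \<open>t\<close> form a countable union of rectangles: a basic
  open set of locations times a down-closed set of birth times.\<close>

lemma arrival_measurable [measurable]: "(\<lambda>g. A g x) \<in> borel_measurable \<Lambda>"
proof (subst borel_measurable_iff_less, intro allI)
  fix t
  obtain U :: "(real ^ 'n) set set" where U: "countable U" "topological_basis U"
    using ex_countable_basis by blast
  \<comment> \<open>Negative times are added to make \<open>S u\<close> down-closed on the whole
    line; the intersection with \<open>{0..}\<close> removes them again.\<close>
  define S where "S u = {s. s < 0 \<or> (\<forall>y\<in>u. A (y, s) x < t)}" for u
  have S: "S u \<in> sets borel" for u
  proof (rule down_closed_set_borel)
    fix s s' assume "s' \<in> S u" "s \<le> s'"
    then show "s \<in> S u"
      by (auto simp: S_def intro: le_less_trans[OF arrival_mono_birth])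
  qed
  have "{g \<in> space \<Lambda>. A g x < t} = (\<Union>u\<in>U. u \<times> (S u \<inter> {0..}))"
  proof (intro equalityI subsetI)
    fix g assume g: "g \<in> {g \<in> space \<Lambda>. A g x < t}"
    obtain y s where ys: "g = (y, s)" "0 \<le> s" "A (y, s) x < t"
      using g by (cases g) (auto simp: space_\<Lambda> germ_space_def)
    have *: "A (y', s) x = A (0, s) (x - y')" for y'
      by (rule homogeneous) fact
    have "continuous_on UNIV (\<lambda>y'. A (0, s) (x - y'))"
      by (rule continuous_on_compose2[OF continuous]) (auto intro!: continuous_intros simp: ys germ_space_def)
    then have "continuous_on UNIV (\<lambda>y'. A (y', s) x)"
      by (simp add: *)
    then have "open {y'. A (y', s) x < t}"
      using open_Collect_less[of "\<lambda>y'. A (y', s) x" "\<lambda>_. t"] by simp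
    then obtain u where "u \<in> U" "y \<in> u" "u \<subseteq> {y'. A (y', s) x < t}"
      using topological_basisE[OF U(2), of _ y] ys by blast
    then show "g \<in> (\<Union>u\<in>U. u \<times> (S u \<inter> {0..}))"
      using ys by (auto simp: S_def)
  qed (auto simp: S_def space_\<Lambda> germ_space_def)
  moreover have "u \<in> sets lborel" if "u \<in> U" for u
    using topological_basis_open[OF U(2) that] by simp
  ultimately show "{g \<in> space \<Lambda>. A g x < t} \<in> sets \<Lambda>"
    using U(1) S by (auto simp: \<Lambda>_eq intro!: sets.countable_UN' pair_measureI sets_m_Int)
qed

lemma early_germs_measurable:
  "{g \<in> germ_space. A g x \<le> t} \<in> sets \<Lambda>" "{g \<in> germ_space. A g x < t} \<in> sets \<Lambda>"
  unfolding space_\<Lambda>[symmetric] by measurable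

text \<open>Stationarity: for each birth time the locations arriving at \<open>x\<close> by time
  \<open>t\<close> are a translate of those arriving at \<open>0\<close>. Integrating the slices
  over \<open>m\<close> uses its sigma-finiteness, obtained from \<open>m_finite\<close>.\<close>

lemma early_germs_measure:
  "measure \<Lambda> {g \<in> germ_space. A g x \<le> t} = measure \<Lambda> (causal_cone A t)"
proof -
  interpret m: sigma_finite_measure m
  proof
    let ?U = "range (\<lambda>i::nat. {0..real (Suc i)})"
    have "{0..real (Suc i)} \<in> sets m" for i
      using sets_m_Int[of "{0..real (Suc i)}"] by simp
    moreover have "\<Union>?U = space m"
    proof -
      have "\<exists>i::nat. s \<le> real (Suc i)" for s
        using real_nat_ceiling_ge[of s] by (intro exI[of _ "nat \<lceil>s\<rceil>"]) linarith
      then show ?thesis by (force simp: space_m)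
    qed
    moreover have "emeasure m {0..real (Suc i)} \<noteq> \<infinity>" for i
      using m_finite[of "real (Suc i)"] by simp
    ultimately show "\<exists>U. countable U \<and> U \<subseteq> sets m \<and> \<Union> U = space m \<and> (\<forall>u\<in>U. emeasure m u \<noteq> \<infinity>)"
      by (intro exI[of _ ?U]) auto
  qed
  interpret lm: pair_sigma_finite lborel m ..
  let ?K = "\<lambda>x. {g \<in> germ_space. A g x \<le> t}"
  let ?slice = "\<lambda>x s. (\<lambda>y. (y, s)) -` ?K x"
  have "emeasure \<Lambda> (?K x) = (\<integral>\<^sup>+s. emeasure lborel (?slice x s) \<partial>m)" for x
    using early_germs_measurable(1) unfolding \<Lambda>_eq by (intro lm.emeasure_pair_measure_alt2)
  moreover have "emeasure lborel (?slice x s) = emeasure lborel (?slice 0 s)" if "s \<in> space m" for s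
  proof -
    have s: "0 \<le> s"
      using that by (simp add: space_m)
    have meas: "?slice x s \<in> sets borel" for x
      using sets_Pair2[of "?K x" lborel m s] early_germs_measurable(1)[of x t] unfolding \<Lambda>_eq by simp
    have "emeasure lborel (?slice x s) = emeasure (distr lborel borel ((+) x)) (?slice x s)"
      by (simp add: lborel_distr_plus)
    also have "\<dots> = emeasure lborel ((+) x -` ?slice x s)"
      using meas by (subst emeasure_distr) auto
    also have "(+) x -` ?slice x s = ?slice 0 s"
      using s homogeneous[OF s, of _ x] homogeneous[OF s, of _ 0] by (auto simp: germ_space_def)
    finally show ?thesis .
  qed
  ultimately have "emeasure \<Lambda> (?K x) = emeasure \<Lambda> (?K 0)"
    by (simp cong: nn_integral_cong)
  then show ?thesis
    by (simp add: measure_def causal_cone_def)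
qed

definition void_event :: "'n germ set \<Rightarrow> 'w set" where
  "void_event B = {\<omega> \<in> space P. N \<omega> \<inter> B = {}}"

text \<open>\<open>card\<close> vanishes on infinite sets too; local finiteness rules these
  out.\<close>

lemma void_event_eq_count: "bounded B \<Longrightarrow> void_event B = {\<omega> \<in> space P. card (N \<omega> \<inter> B) = 0}"
  using locally_finite[of _ B] by (auto simp: void_event_def)

lemma void_event_measurable:
  assumes "B \<in> sets \<Lambda>" "bounded B"
  shows "void_event B \<in> events"
  using measurable_sets[OF measurable_count[OF assms], of "{0}"] assms
  by (simp add: void_event_eq_count vimage_def Int_def conj_commute)

lemma prob_void_event:
  assumes "B \<in> sets \<Lambda>" "bounded B"
  shows "prob (void_event B) = exp (- measure \<Lambda> B)"
  using poisson_count[OF assms, of 0] assms by (simp add: void_event_eq_count)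

lemma void_events_independent:
  assumes B: "B \<in> sets \<Lambda>" "bounded B" and B': "B' \<in> sets \<Lambda>" "bounded B'" and disj: "B \<inter> B' = {}"
  shows "prob (void_event B \<inter> void_event B') = prob (void_event B) * prob (void_event B')"
proof -
  let ?B = "\<lambda>i::nat. if i = 0 then B else B'"
  let ?E = "\<lambda>i. (\<lambda>\<omega>. card (N \<omega> \<inter> ?B i)) -` {0} \<inter> space P"
  have "disjoint_family_on ?B {..<2}"
    using disj by (auto simp: disjoint_family_on_def)
  then have "indep_vars (\<lambda>_. count_space UNIV) (\<lambda>i \<omega>. card (N \<omega> \<inter> ?B i)) {..<2}"
    using B B' by (intro independent_counts) auto
  then have "prob (\<Inter>i\<in>{..<2}. ?E i) = (\<Prod>i\<in>{..<2}. prob (?E i))"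
    by (rule indep_varsD_finite) (auto simp: lessThan_empty_iff)
  moreover have "{..<2} = {0, 1::nat}" by auto
  moreover have "?E 0 = void_event B" "?E 1 = void_event B'"
    using B B' by (auto simp: void_event_eq_count)
  ultimately show ?thesis by simp
qed

definition bounded_parts :: "'n germ set \<Rightarrow> 'n germ set set" where
  "bounded_parts W = {B \<in> sets \<Lambda>. bounded B \<and> B \<subseteq> W}"

text \<open>Void events are taken as generators instead of counts: they already determine the field
  of \<open>N \<omega> \<inter> W\<close>, and they are closed under intersection.\<close>

definition void_algebra :: "'n germ set \<Rightarrow> 'w measure" where
  "void_algebra W = sigma (space P) (void_event ` bounded_parts W)"

lemma void_events_Pow: "void_event ` X \<subseteq> Pow (space P)"
  by (auto simp: void_event_def)

lemma space_void_algebra [simp]: "space (void_algebra W) = space P"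
  by (simp add: void_algebra_def void_events_Pow)

lemma sets_void_algebra:
  "sets (void_algebra W) = sigma_sets (space P) (void_event ` bounded_parts W)"
  by (simp add: void_algebra_def void_events_Pow)

lemma sets_void_algebra_subset: "sets (void_algebra W) \<subseteq> events"
  unfolding sets_void_algebra
  by (rule sets.sigma_sets_subset) (auto simp: bounded_parts_def void_event_measurable)

lemma void_event_in_void_algebra: "B \<in> bounded_parts W \<Longrightarrow> void_event B \<in> sets (void_algebra W)"
  by (simp add: sets_void_algebra)

text \<open>Two sets of germs are both void iff their union is, so the generators form a pi-system;
  independence passes from them to the generated algebras.\<close>

lemma void_algebras_independent:
  assumes "W \<inter> W' = {}"
  shows "indep_set (sets (void_algebra W)) (sets (void_algebra W'))"
proof -
  have "Int_stable (void_event ` bounded_parts W)" for W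
  proof (rule Int_stableI)
    fix a b assume "a \<in> void_event ` bounded_parts W" "b \<in> void_event ` bounded_parts W"
    then obtain B B' where B: "B \<in> bounded_parts W" "a = void_event B"
        "B' \<in> bounded_parts W" "b = void_event B'"
      by blast
    then have "a \<inter> b = void_event (B \<union> B')" "B \<union> B' \<in> bounded_parts W"
      by (auto simp: void_event_def bounded_parts_def)
    then show "a \<inter> b \<in> void_event ` bounded_parts W" by blast
  qed
  moreover have "indep_set (void_event ` bounded_parts W) (void_event ` bounded_parts W')"
    using assms
    by (intro indep_setI) (auto simp: bounded_parts_def intro!: void_event_measurable void_events_independent)
  ultimately show ?thesis
    unfolding sets_void_algebra by (intro indep_set_sigma_sets)
qed

text \<open>
  Where \<open>N \<omega> \<inter> W\<close> is empty, the field is the unspecified constant \<open>Inf {}\<close>; the event \<open>void_event W\<close>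
  takes care of this, although \<open>W\<close> need not be bounded.
\<close>

lemma crystal_field_measurable:
  assumes W: "W \<in> sets \<Lambda>"
  shows "(\<lambda>\<omega>. crystal_field A (N \<omega> \<inter> W) x) \<in> borel_measurable (void_algebra W)"
proof (subst borel_measurable_iff_less, intro allI)
  fix t
  let ?V = "void_algebra W"
  let ?B = "\<lambda>x t. W \<inter> {g \<in> germ_space. A g x < t}"
  have V: "void_event (?B x t) \<in> sets ?V" for x t
  proof (rule void_event_in_void_algebra)
    have "bounded (?B x t)"
      by (rule bounded_subset[OF bounded_early_germs[of x t]]) auto
    then show "?B x t \<in> bounded_parts W"
      using W early_germs_measurable(2) by (auto simp: bounded_parts_def)
  qed
  have W': "W \<subseteq> germ_space"
    using sets.sets_into_space[OF W] by (simp add: space_\<Lambda>)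
  \<comment> \<open>Since \<open>W\<close> may be unbounded, it is exhausted by the bounded sets of
    its germs that reach the origin before time \<open>k\<close>.\<close>
  have "void_event W = (\<Inter>k::nat. void_event (?B 0 (real k)))"
  proof (intro equalityI subsetI)
    fix \<omega> assume "\<omega> \<in> (\<Inter>k::nat. void_event (?B 0 (real k)))"
    then have \<omega>: "\<omega> \<in> space P" "\<And>k::nat. N \<omega> \<inter> ?B 0 (real k) = {}"
      by (auto simp: void_event_def)
    have "g \<notin> W" if "g \<in> N \<omega>" for g
      using \<omega>(2) reals_Archimedean2[of "A g 0"] that W' by blast
    then show "\<omega> \<in> void_event W"
      using \<omega>(1) by (auto simp: void_event_def)
  qed (auto simp: void_event_def)
  also have "\<dots> \<in> sets ?V"
    using V by (intro sets.countable_INT) auto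
  finally have empty: "void_event W \<in> sets ?V" .
  have "{\<omega> \<in> space ?V. crystal_field A (N \<omega> \<inter> W) x < t} =
      (space ?V - void_event (?B x t)) \<union> (if Inf {} < t then void_event W else {})"
  proof (intro set_eqI)
    fix \<omega>
    show "\<omega> \<in> {\<omega> \<in> space ?V. crystal_field A (N \<omega> \<inter> W) x < t} \<longleftrightarrow>
      \<omega> \<in> (space ?V - void_event (?B x t)) \<union> (if Inf {} < t then void_event W else {})"
    proof (cases "N \<omega> \<inter> W = {}")
      case True
      then show ?thesis
        by (auto simp: void_event_def crystal_field_def)
    next
      case False
      have "crystal_field A (N \<omega> \<inter> W) x < t \<longleftrightarrow> (\<exists>g\<in>N \<omega> \<inter> W. A g x < t)"
        unfolding crystal_field_def
      proof (rule cINF_less_iff[OF False])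
        show "bdd_below ((\<lambda>g. A g x) ` (N \<omega> \<inter> W))"
          using nonneg W' by (auto intro!: bdd_belowI[of _ 0])
      qed
      then show ?thesis
        using False W' by (auto simp: void_event_def)
    qed
  qed
  also have "\<dots> \<in> sets ?V"
    by (intro sets.Un sets.compl_sets V) (simp add: empty)
  finally show "{\<omega> \<in> space ?V. crystal_field A (N \<omega> \<inter> W) x < t} \<in> sets ?V" .
qed

lemma restricted_field_measurable:
  assumes W: "W \<in> sets \<Lambda>"
  shows "(\<lambda>\<omega>. restrict (crystal_field A (N \<omega> \<inter> W)) T) \<in> void_algebra W \<rightarrow>\<^sub>M continuous_functions T"
  unfolding continuous_functions_def
proof (rule measurable_restrict_space2)
  show "(\<lambda>\<omega>. restrict (crystal_field A (N \<omega> \<inter> W)) T) \<in> void_algebra W \<rightarrow>\<^sub>M Pi\<^sub>M T (\<lambda>_. borel)"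
    using crystal_field_measurable[OF W] by (intro measurable_restrict) auto
  have "continuous_on T (crystal_field A (N \<omega> \<inter> W))" if "\<omega> \<in> space P" for \<omega>
  proof (rule continuous_on_subset[OF continuous_on_crystal_field])
    show "N \<omega> \<inter> W \<subseteq> germ_space"
      using points_germs[OF that] by blast
    show "finite (N \<omega> \<inter> W \<inter> B)" if "bounded B" for B
      by (rule finite_subset[OF _ locally_finite[OF \<open>\<omega> \<in> space P\<close> that]]) auto
  qed simp
  then show "(\<lambda>\<omega>. restrict (crystal_field A (N \<omega> \<inter> W)) T) \<in> space (void_algebra W) \<rightarrow> {f. continuous_on T f}"
    by (auto cong: continuous_on_cong)
qed

lemma restricted_field_random_variable:
  assumes W: "W \<in> sets \<Lambda>"
  shows "(\<lambda>\<omega>. restrict (crystal_field A (N \<omega> \<inter> W)) T) \<in> P \<rightarrow>\<^sub>M continuous_functions T"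
  using restricted_field_measurable[OF W, of T] sets_void_algebra_subset[of W]
  by (auto simp: measurable_def)

text \<open>Each field generates a sub-algebra of the void algebra of its own set of germs.\<close>

lemma restricted_fields_independent:
  assumes W: "W \<in> sets \<Lambda>" and W': "W' \<in> sets \<Lambda>" and disj: "W \<inter> W' = {}"
  shows "indep_var (continuous_functions T) (\<lambda>\<omega>. restrict (crystal_field A (N \<omega> \<inter> W)) T)
    (continuous_functions T') (\<lambda>\<omega>. restrict (crystal_field A (N \<omega> \<inter> W')) T')"
proof -
  let ?X = "\<lambda>W T \<omega>. restrict (crystal_field A (N \<omega> \<inter> W)) T"
  let ?G = "\<lambda>W T. sigma_sets (space P) {?X W T -` B \<inter> space P | B. B \<in> sets (continuous_functions T)}"
  have sub: "?G W T \<subseteq> sets (void_algebra W)" if W: "W \<in> sets \<Lambda>" for W and T :: "(real ^ 'n) set"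
  proof -
    have "{?X W T -` B \<inter> space P | B. B \<in> sets (continuous_functions T)} \<subseteq> sets (void_algebra W)"
      using measurable_sets[OF restricted_field_measurable[OF W, of T]] by auto
    from sets.sigma_sets_subset[OF this] show ?thesis by simp
  qed
  have "indep_set (?G W T) (?G W' T')"
    unfolding indep_sets2_eq
  proof (intro conjI ballI)
    show "?G W T \<subseteq> events" "?G W' T' \<subseteq> events"
      using sub[OF W] sub[OF W'] sets_void_algebra_subset by (meson subset_trans)+
    show "prob (a \<inter> b) = prob a * prob b" if "a \<in> ?G W T" "b \<in> ?G W' T'" for a b
      using indep_setD[OF void_algebras_independent[OF disj]] sub[OF W] sub[OF W'] that by blast
  qed
  then show ?thesis
    unfolding indep_var_eq using restricted_field_random_variable W W' by blast
qed

end


subsection \<open>Coupling\<close>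


text \<open>The coupling inequality: the preimages of \<open>B\<close> under \<open>X\<close> and
  \<open>Y\<close> differ only inside \<open>D\<close>.\<close>

lemma (in prob_space) measure_distr_diff_le:
  assumes [measurable]: "X \<in> M \<rightarrow>\<^sub>M S" "Y \<in> M \<rightarrow>\<^sub>M S" and D: "D \<in> events"
    and eq: "\<And>\<omega>. \<omega> \<in> space M - D \<Longrightarrow> X \<omega> = Y \<omega>" and B: "B \<in> sets S"
  shows "\<bar>measure (distr M S X) B - measure (distr M S Y) B\<bar> \<le> prob D"
proof -
  have *: "prob (X -` B \<inter> space M) \<le> prob (Y -` B \<inter> space M) + prob D"
    if "X \<in> M \<rightarrow>\<^sub>M S" "Y \<in> M \<rightarrow>\<^sub>M S" "\<And>\<omega>. \<omega> \<in> space M - D \<Longrightarrow> X \<omega> = Y \<omega>" for X Y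
  proof -
    have "prob (X -` B \<inter> space M) \<le> prob ((Y -` B \<inter> space M) \<union> D)"
    proof (rule finite_measure_mono)
      show "X -` B \<inter> space M \<subseteq> (Y -` B \<inter> space M) \<union> D"
        using that(3) by auto
      show "(Y -` B \<inter> space M) \<union> D \<in> events"
        using measurable_sets[OF that(2) B] D by auto
    qed
    also have "\<dots> \<le> prob (Y -` B \<inter> space M) + prob D"
      using measurable_sets[OF that(2) B] D by (intro measure_Un_le)
    finally show ?thesis .
  qed
  have "measure (distr M S X) B = prob (X -` B \<inter> space M)"
    "measure (distr M S Y) B = prob (Y -` B \<inter> space M)"
    using B by (simp_all add: measure_distr)
  then show ?thesis
    using *[of X Y] *[of Y X] eq by (simp add: abs_le_iff)
qed

text \<open>Both laws are compared with the joint law of \<open>X'\<close> and \<open>Y'\<close>,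
  which is the product of its marginals. Each comparison costs \<open>prob D + prob E\<close> per
  event, and the total variation norm doubles the sum.\<close>

lemma (in prob_space) tv_norm_joint_law_le:
  assumes X: "X \<in> M \<rightarrow>\<^sub>M S" and Y: "Y \<in> M \<rightarrow>\<^sub>M T" and indep: "indep_var S X' T Y'"
    and D: "D \<in> events" "\<And>\<omega>. \<omega> \<in> space M - D \<Longrightarrow> X \<omega> = X' \<omega>"
    and E: "E \<in> events" "\<And>\<omega>. \<omega> \<in> space M - E \<Longrightarrow> Y \<omega> = Y' \<omega>"
  shows "tv_norm (distr M (S \<Otimes>\<^sub>M T) (\<lambda>\<omega>. (X \<omega>, Y \<omega>))) (distr M S X \<Otimes>\<^sub>M distr M T Y)
    \<le> 4 * (emeasure M D + emeasure M E)"
proof -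
  let ?J = "distr M (S \<Otimes>\<^sub>M T) (\<lambda>\<omega>. (X \<omega>, Y \<omega>))" and ?J' = "distr M (S \<Otimes>\<^sub>M T) (\<lambda>\<omega>. (X' \<omega>, Y' \<omega>))"
  let ?I = "distr M S X \<Otimes>\<^sub>M distr M T Y" and ?I' = "distr M S X' \<Otimes>\<^sub>M distr M T Y'"
  have X': "X' \<in> M \<rightarrow>\<^sub>M S" and Y': "Y' \<in> M \<rightarrow>\<^sub>M T" and J'I': "?I' = ?J'"
    using indep unfolding indep_var_distribution_eq by auto
  interpret PP: pair_prob_space M M ..
  \<comment> \<open>Realized on two independent copies of the space, the product of the marginals is
    itself a law of a pair, and the same coupling inequality applies to it.\<close>
  have prod: "distr M S X \<Otimes>\<^sub>M distr M T Y = distr (M \<Otimes>\<^sub>M M) (S \<Otimes>\<^sub>M T) (\<lambda>(\<omega>, \<omega>'). (X \<omega>, Y \<omega>'))"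
    if "X \<in> M \<rightarrow>\<^sub>M S" "Y \<in> M \<rightarrow>\<^sub>M T" for X Y
    using that prob_space_distr[OF that(2)]
    by (intro pair_measure_distr) (auto intro: prob_space_imp_sigma_finite)
  have pair: "(\<lambda>(\<omega>, \<omega>'). (X \<omega>, Y \<omega>')) \<in> M \<Otimes>\<^sub>M M \<rightarrow>\<^sub>M S \<Otimes>\<^sub>M T"
    if "X \<in> M \<rightarrow>\<^sub>M S" "Y \<in> M \<rightarrow>\<^sub>M T" for X Y
    using that by measurable
  have "\<bar>measure ?J B - measure ?I B\<bar> \<le> 2 * (prob D + prob E)" if B: "B \<in> sets (S \<Otimes>\<^sub>M T)" for B
  proof -
    have "\<bar>measure ?J B - measure ?J' B\<bar> \<le> prob (D \<union> E)"
      using X Y X' Y' D E B by (intro measure_distr_diff_le) auto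
    also have "\<dots> \<le> prob D + prob E"
      using D E by (intro measure_Un_le)
    finally have 1: "\<bar>measure ?J B - measure ?J' B\<bar> \<le> prob D + prob E" .
    let ?D = "D \<times> space M" and ?E = "space M \<times> E"
    have DE: "?D \<in> sets (M \<Otimes>\<^sub>M M)" "?E \<in> sets (M \<Otimes>\<^sub>M M)"
      using D E by auto
    have "\<bar>measure ?I B - measure ?I' B\<bar> \<le> measure (M \<Otimes>\<^sub>M M) (?D \<union> ?E)"
      unfolding prod[OF X Y] prod[OF X' Y']
    proof (rule PP.measure_distr_diff_le[OF pair[OF X Y] pair[OF X' Y'] _ _ B])
      show "?D \<union> ?E \<in> sets (M \<Otimes>\<^sub>M M)"
        using DE by auto
    qed (use D E in \<open>auto simp: space_pair_measure\<close>)
    also have "\<dots> \<le> measure (M \<Otimes>\<^sub>M M) ?D + measure (M \<Otimes>\<^sub>M M) ?E"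
      using DE by (intro measure_Un_le)
    also have "\<dots> = prob D + prob E"
      using D E by (simp add: measure_def emeasure_pair_measure_Times emeasure_space_1)
    finally show ?thesis
      using 1 J'I' by simp
  qed
  then have "(SUP B\<in>sets ?J. ennreal \<bar>measure ?J B - measure ?I B\<bar>) \<le> ennreal (2 * (prob D + prob E))"
    by (intro SUP_least ennreal_leI) simp
  also have "\<dots> = 2 * (emeasure M D + emeasure M E)"
    by (simp add: ennreal_mult emeasure_eq_measure)
  finally have S: "(SUP B\<in>sets ?J. ennreal \<bar>measure ?J B - measure ?I B\<bar>) \<le> 2 * (emeasure M D + emeasure M E)" .
  have "tv_norm ?J ?I = 2 * (SUP B\<in>sets ?J. ennreal \<bar>measure ?J B - measure ?I B\<bar>)"
  proof (rule tv_norm_prob_space)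
    show "prob_space ?J"
      using X Y by (intro prob_space_distr) auto
    show "prob_space ?I"
      unfolding prod[OF X Y] by (rule PP.prob_space_distr[OF pair[OF X Y]])
    show "sets ?J = sets ?I"
      by (simp cong: sets_pair_measure_cong)
  qed
  also have "\<dots> \<le> 2 * (2 * (emeasure M D + emeasure M E))"
    by (rule mult_left_mono[OF S]) simp
  finally show ?thesis
    by (simp add: mult.assoc[symmetric])
qed

section \<open>Localization of the field and assembly of the bound\<close>

context crystal_process
begin

text \<open>\<open>D\<close> is the event that some corner of level \<open>k\<close> is missed up to
  time \<open>C * real (Suc k)\<close>. By stationarity each miss has probability
  \<open>exp (- F (C * real (Suc k)))\<close>, with \<open>F\<close> as in the theorem, and a union
  bound over corners and levels gives the series; off \<open>D\<close>,
  \<open>crystal_field_eq_of_hits\<close> applies.\<close>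

lemma crystal_field_localized:
  fixes b :: "real ^ 'n" and \<sigma> r C :: real
  assumes \<sigma>: "\<bar>\<sigma>\<bar> = 1" and r: "0 < r" and C: "8 * A0 * real CARD('n) * (M * C) \<le> r"
    and W: "\<And>g. g \<in> germ_space \<Longrightarrow> \<sigma> * inner diagonal (fst g - b) < r \<Longrightarrow> g \<in> W"
    and T: "\<And>x i. x \<in> T \<Longrightarrow> \<sigma> * (x $ i - b $ i) \<le> 0"
  obtains D where "D \<in> events"
    and "emeasure P D \<le>
      (\<Sum>k. ennreal (real (Suc k) ^ (CARD('n) - 1) * exp (- measure \<Lambda> (causal_cone A (C * real (Suc k))))))"
    and "\<forall>\<omega>\<in>space P - D.
      restrict (crystal_field A (N \<omega>)) T = restrict (crystal_field A (N \<omega> \<inter> W)) T"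
proof -
  define s where "s = 3 * r / (4 * A0 * sqrt (real CARD('n)))"
  let ?corner = "lattice_corner \<sigma> s b"
  let ?F = "\<lambda>t. measure \<Lambda> (causal_cone A t)"
  let ?level = "\<lambda>k. {n :: 'n \<Rightarrow> nat. sum n UNIV = k}"
  let ?miss = "\<lambda>k n. void_event {g \<in> germ_space. A g (?corner n) \<le> C * real (Suc k)}"
  have miss: "?miss k n \<in> events" "prob (?miss k n) = exp (- ?F (C * real (Suc k)))" for k n
    using void_event_measurable prob_void_event early_germs_measurable(1) bounded_early_germs
    by (simp_all add: early_germs_measure)
  define L where "L k = (\<Union>n\<in>?level k. ?miss k n)" for k
  have L: "L k \<in> events" for k
    unfolding L_def using finite_functions_with_sum miss(1) by (intro sets.finite_UN) auto
  have "emeasure P (L k) \<le> ennreal (real (Suc k) ^ (CARD('n) - 1) * exp (- ?F (C * real (Suc k))))" for k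
  proof -
    have "prob (L k) \<le> (\<Sum>n\<in>?level k. prob (?miss k n))"
      unfolding L_def using finite_functions_with_sum miss(1)
      by (intro finite_measure_subadditive_finite) auto
    also have "\<dots> = real (card (?level k)) * exp (- ?F (C * real (Suc k)))"
      by (simp only: miss(2) sum_constant)
    also have "\<dots> \<le> real (Suc k ^ (CARD('n) - 1)) * exp (- ?F (C * real (Suc k)))"
      by (intro mult_right_mono of_nat_mono card_functions_with_sum_le) simp
    finally show ?thesis
      by (simp add: emeasure_eq_measure ennreal_leI)
  qed
  then have "(\<Sum>k. emeasure P (L k)) \<le>
      (\<Sum>k. ennreal (real (Suc k) ^ (CARD('n) - 1) * exp (- ?F (C * real (Suc k)))))"
    by (intro suminf_le) auto
  moreover have "emeasure P (\<Union>k. L k) \<le> (\<Sum>k. emeasure P (L k))"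
    using L by (intro emeasure_subadditive_countably) auto
  moreover have "(\<Union>k. L k) \<in> events"
    using L by blast
  moreover have "restrict (crystal_field A (N \<omega>)) T = restrict (crystal_field A (N \<omega> \<inter> W)) T"
    if \<omega>: "\<omega> \<in> space P - (\<Union>k. L k)" for \<omega>
  proof (rule restrict_ext)
    fix x assume "x \<in> T"
    show "crystal_field A (N \<omega>) x = crystal_field A (N \<omega> \<inter> W) x"
    proof (rule crystal_field_eq_of_hits[OF \<sigma> r C s_def _ W])
      show "N \<omega> \<subseteq> germ_space"
        using \<omega> points_germs by blast
      show "\<exists>g\<in>N \<omega>. A g (?corner n) \<le> C * real (Suc (sum n UNIV))" for n
      proof -
        have "\<omega> \<notin> ?miss (sum n UNIV) n"
          using \<omega> by (auto simp: L_def)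
        then show ?thesis
          using \<omega> by (auto simp: void_event_def)
      qed
    qed (use T \<open>x \<in> T\<close> in auto)
  qed
  ultimately show thesis
    by (intro that[of "\<Union>k. L k"]) auto
qed

end

theorem theorem3:
  fixes A :: "'n::finite germ \<Rightarrow> real ^ 'n \<Rightarrow> real"
    and M A0 r R H C :: real
    and m :: "real measure" and \<Lambda> :: "'n germ measure"
    and P :: "'w measure" and N :: "'w \<Rightarrow> 'n germ set"
    and \<xi> :: "'w \<Rightarrow> real ^ 'n \<Rightarrow> real" and F :: "real \<Rightarrow> real"
    and e a :: "real ^ 'n" and T\<^sub>1 T\<^sub>2 :: "(real ^ 'n) set"
  assumes dim: "CARD('n) \<ge> 2"
    and crystals: "crystal_family A M A0"
    and sets_m: "sets m = sets (restrict_space borel {0..})"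
    and m_nonzero: "emeasure m (space m) \<noteq> 0"
    and m_finite: "\<And>s. 0 < s \<Longrightarrow> emeasure m {0..s} < \<infinity>"
    and \<Lambda>: "\<Lambda> = lborel \<Otimes>\<^sub>M m"
    and poisson: "poisson_point_process P \<Lambda> N"
    and \<xi>: "\<And>\<omega>. \<xi> \<omega> = crystal_field A (N \<omega>)"
    and F: "\<And>t. F t = measure \<Lambda> (causal_cone A t)"
    and e: "e = (1 / sqrt (real CARD('n))) *\<^sub>R (\<chi> i. 1)"
    and a: "inner e a > 0"
    and r: "2 * r = inner e a"
    and T\<^sub>1: "T\<^sub>1 = {x. \<forall>i. x $ i \<le> 0}"
    and T\<^sub>2: "T\<^sub>2 = {x. \<forall>i. a $ i \<le> x $ i}"
    and H: "H = 2 * (A0 + M)"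
    and R: "R = r / H"
    and C: "C = 2 * R / (real CARD('n) * H)"
  shows "absolute_regularity P \<xi> T\<^sub>1 T\<^sub>2
    \<le> 16 * (\<Sum>k. ennreal (real (Suc k) ^ (CARD('n) - 1) * exp (- F (C * real (Suc k)))))"
proof -
  interpret crystal_process A M A0 P \<Lambda> N m
    using crystals poisson sets_m m_finite \<Lambda>
    by (intro crystal_process.intro crystal_process_axioms.intro)
  have e_diagonal: "e = diagonal"
    by (simp add: e diagonal_def)
  have r_pos: "0 < r"
    using a r by simp
  \<comment> \<open>The left side equals \<open>r * (4 * (A0 * M)) / (A0 + M)\<^sup>2\<close>, so
    this is the inequality between arithmetic and geometric means of \<open>A0\<close> and
    \<open>M\<close>.\<close>
  have C_small: "8 * A0 * real CARD('n) * (M * C) \<le> r"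
  proof -
    have "4 * (A0 * M) \<le> (A0 + M)\<^sup>2"
      using zero_le_power2[of "A0 - M"] by (simp add: power2_eq_square algebra_simps)
    then have "r * (4 * (A0 * M)) \<le> r * (A0 + M)\<^sup>2"
      using r_pos by simp
    moreover have "H * H = 4 * (A0 + M)\<^sup>2"
      by (simp add: H power2_eq_square algebra_simps)
    then have "8 * A0 * real CARD('n) * (M * C) = 16 * (A0 * M * r) / (4 * (A0 + M)\<^sup>2)"
      by (simp add: C R)
    then have "8 * A0 * real CARD('n) * (M * C) = r * (4 * (A0 * M)) / (A0 + M)\<^sup>2"
      by simp
    ultimately show ?thesis
      using A0_pos M_pos by (simp add: divide_le_eq)
  qed
  define S where "S = (\<Sum>k. ennreal (real (Suc k) ^ (CARD('n) - 1) *
    exp (- measure \<Lambda> (causal_cone A (C * real (Suc k))))))"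
  define W\<^sub>1 where "W\<^sub>1 = {g \<in> germ_space. inner e (fst g) < r}"
  define W\<^sub>2 where "W\<^sub>2 = {g \<in> germ_space. r \<le> inner e (fst g)}"
  have "fst \<in> borel_measurable \<Lambda>"
    unfolding \<Lambda>_eq using measurable_fst[of lborel m] by simp
  then have W: "W\<^sub>1 \<in> sets \<Lambda>" "W\<^sub>2 \<in> sets \<Lambda>"
    unfolding W\<^sub>1_def W\<^sub>2_def space_\<Lambda>[symmetric] by measurable
  have disj: "W\<^sub>1 \<inter> W\<^sub>2 = {}"
    by (auto simp: W\<^sub>1_def W\<^sub>2_def)
  \<comment> \<open>The apex \<open>a\<close> of \<open>T\<^sub>2\<close> is at height
    \<open>2 * r\<close>, so being less than \<open>r\<close> below it means lying above the
    hyperplane at height \<open>r\<close>; the same lemma thus serves both sides with opposite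
    signs.\<close>
  have side\<^sub>1: "\<And>g. g \<in> germ_space \<Longrightarrow> 1 * inner diagonal (fst g - 0) < r \<Longrightarrow> g \<in> W\<^sub>1"
      "\<And>x i. x \<in> T\<^sub>1 \<Longrightarrow> 1 * (x $ i - 0 $ i) \<le> 0"
    and side\<^sub>2: "\<And>g. g \<in> germ_space \<Longrightarrow> - 1 * inner diagonal (fst g - a) < r \<Longrightarrow> g \<in> W\<^sub>2"
      "\<And>x i. x \<in> T\<^sub>2 \<Longrightarrow> - 1 * (x $ i - a $ i) \<le> 0"
    using r by (simp_all add: W\<^sub>1_def W\<^sub>2_def T\<^sub>1 T\<^sub>2 e_diagonal inner_diff_right)
  obtain D\<^sub>1 where D\<^sub>1: "D\<^sub>1 \<in> events" "emeasure P D\<^sub>1 \<le> S"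
    "\<forall>\<omega>\<in>space P - D\<^sub>1. restrict (\<xi> \<omega>) T\<^sub>1 = restrict (crystal_field A (N \<omega> \<inter> W\<^sub>1)) T\<^sub>1"
    unfolding S_def \<xi>
    by (rule crystal_field_localized[OF _ r_pos C_small side\<^sub>1]) (simp, blast)
  obtain D\<^sub>2 where D\<^sub>2: "D\<^sub>2 \<in> events" "emeasure P D\<^sub>2 \<le> S"
    "\<forall>\<omega>\<in>space P - D\<^sub>2. restrict (\<xi> \<omega>) T\<^sub>2 = restrict (crystal_field A (N \<omega> \<inter> W\<^sub>2)) T\<^sub>2"
    unfolding S_def \<xi>
    by (rule crystal_field_localized[OF _ r_pos C_small side\<^sub>2]) (simp, blast)
  let ?X = "\<lambda>T \<omega>. restrict (\<xi> \<omega>) T"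
  have X: "?X T \<in> P \<rightarrow>\<^sub>M continuous_functions T" for T
  proof -
    \<comment> \<open>The full field is the case where the restricting set is all of
      \<open>germ_space\<close>.\<close>
    have "germ_space \<in> sets \<Lambda>"
      unfolding space_\<Lambda>[symmetric] by simp
    from restricted_field_random_variable[OF this, of T] show ?thesis
      using points_germs by (simp add: \<xi> Int_absorb2 cong: measurable_cong)
  qed
  have "(\<lambda>f. restrict f T) \<in> continuous_functions (T \<union> T') \<rightarrow>\<^sub>M continuous_functions T"
    for T T' :: "(real ^ 'n) set"
    unfolding continuous_functions_def
  proof (rule measurable_restrict_space2)
    show "(\<lambda>f. restrict f T) \<in> restrict_space (Pi\<^sub>M (T \<union> T') (\<lambda>_. borel)) {f. continuous_on (T \<union> T') f}
        \<rightarrow>\<^sub>M Pi\<^sub>M T (\<lambda>_. borel)"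
      by (intro measurable_restrict_space1 measurable_restrict_subset) auto
    show "(\<lambda>f. restrict f T) \<in> space (restrict_space (Pi\<^sub>M (T \<union> T') (\<lambda>_. borel))
        {f. continuous_on (T \<union> T') f}) \<rightarrow> {f. continuous_on T f}"
      by (auto simp: space_restrict_space cong: continuous_on_cong intro: continuous_on_subset)
  qed
  from this[of T\<^sub>1 T\<^sub>2] this[of T\<^sub>2 T\<^sub>1]
  have pair: "(\<lambda>f. (restrict f T\<^sub>1, restrict f T\<^sub>2)) \<in>
      continuous_functions (T\<^sub>1 \<union> T\<^sub>2) \<rightarrow>\<^sub>M continuous_functions T\<^sub>1 \<Otimes>\<^sub>M continuous_functions T\<^sub>2"
    by (intro measurable_Pair) (simp_all add: Un_commute)
  have "distr (restriction_law P \<xi> (T\<^sub>1 \<union> T\<^sub>2)) (continuous_functions T\<^sub>1 \<Otimes>\<^sub>M continuous_functions T\<^sub>2)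
      (\<lambda>f. (restrict f T\<^sub>1, restrict f T\<^sub>2)) =
    distr P (continuous_functions T\<^sub>1 \<Otimes>\<^sub>M continuous_functions T\<^sub>2) (\<lambda>\<omega>. (?X T\<^sub>1 \<omega>, ?X T\<^sub>2 \<omega>))"
    unfolding restriction_law_def distr_distr[OF pair X]
    by (intro distr_cong) (auto simp: Int_absorb1)
  then have "absolute_regularity P \<xi> T\<^sub>1 T\<^sub>2 \<le> 4 * (emeasure P D\<^sub>1 + emeasure P D\<^sub>2)"
    unfolding absolute_regularity_def restriction_law_def
    using tv_norm_joint_law_le[OF X X restricted_fields_independent[OF W disj]
      D\<^sub>1(1) D\<^sub>1(3)[rule_format] D\<^sub>2(1) D\<^sub>2(3)[rule_format]] by simp
  also have "\<dots> \<le> 4 * (S + S)"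
    using D\<^sub>1(2) D\<^sub>2(2) by (intro mult_left_mono add_mono) auto
  also have "\<dots> = 8 * S"
    by (simp add: mult_2[symmetric] mult.assoc[symmetric])
  also have "\<dots> \<le> 16 * S"
    by (intro mult_right_mono) auto
  finally show ?thesis
    by (simp add: S_def F)
qed

end
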